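(* An operator $S$ is a bounded hermitian operator on $\mathcal{Z}_0$ if and only if there exist real numbers $\alpha_1,\alpha_2,\alpha_3$ such that $$(Sf)(z)=\alpha_1 f(0)+\alpha_2 f'(0)\,z+\alpha_3 f(z)$$ for all $f\in\mathcal{Z}_0$ and $z\in\triangle$.
   Context: $\triangle=\{z\in\mathbb{C}:|z|<1\}$ is the open unit disc. The Zygmund space $\mathcal{Z}$ is the set of all analytic functions $f:\triangle\to\mathbb{C}$ that extend continuously to the boundary of $\triangle$ and satisfy $\sup_{|z|<1}(1-|z|^2)|f''(z)|<\infty$, with norm $\|f\|_{\mathcal{Z}}=|f(0)|+|f'(0)|+\sup_{|z|<1}(1-|z|^2)|f''(z)|$. The little Zygmund space is the closed subspace $\mathcal{Z}_0=\{f\in\mathcal{Z}:\lim_{|z|\to1^-}(1-|z|^2)|f''(z)|=0\}$ with the inherited norm. A bounded linear operator $S$ on a complex Banach space is hermitian if $e^{itS}$ is a (surjective) isometry for every $t\in\mathbb{R}$. *)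

theory Defs
  imports "HOL-Complex_Analysis.Complex_Analysis"
begin

section \<open>Hermitian operators on complex Banach spaces\<close>

class scaleC =
  fixes scaleC :: "complex \<Rightarrow> 'a \<Rightarrow> 'a"  (infixr \<open>*\<^sub>C\<close> 75)

class complex_normed_vector = real_normed_vector + scaleC +
  assumes scaleC_add_right: "a *\<^sub>C (x + y) = a *\<^sub>C x + a *\<^sub>C y"
    and scaleC_add_left: "(a + b) *\<^sub>C x = a *\<^sub>C x + b *\<^sub>C x"
    and scaleC_scaleC: "a *\<^sub>C b *\<^sub>C x = (a * b) *\<^sub>C x"
    and scaleC_one: "1 *\<^sub>C x = x"
    and scaleR_scaleC: "r *\<^sub>R x = of_real r *\<^sub>C x"
    and norm_scaleC: "norm (a *\<^sub>C x) = cmod a * norm x"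

class complex_banach = complex_normed_vector + banach

definition bounded_clinear :: "('a::complex_normed_vector \<Rightarrow> 'b::complex_normed_vector) \<Rightarrow> bool"
  where "bounded_clinear S \<longleftrightarrow> bounded_linear S \<and> (\<forall>c x. S (c *\<^sub>C x) = c *\<^sub>C S x)"

text \<open>The operator exponential is taken pointwise. For bounded \<open>T\<close> on a Banach space the
  series converges absolutely at every \<open>x\<close>, and its sum is the value at \<open>x\<close> of the
  operator-norm limit.\<close>

definition exp_op :: "('a::complex_banach \<Rightarrow> 'a) \<Rightarrow> 'a \<Rightarrow> 'a"
  where "exp_op T x = (\<Sum>n. (T ^^ n) x /\<^sub>R fact n)"

definition surj_isometry :: "('a::metric_space \<Rightarrow> 'b::metric_space) \<Rightarrow> bool"
  where "surj_isometry U \<longleftrightarrow> (\<forall>x y. dist (U x) (U y) = dist x y) \<and> surj U"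

definition bounded_hermitian :: "('a::complex_banach \<Rightarrow> 'a) \<Rightarrow> bool"
  where "bounded_hermitian S \<longleftrightarrow>
    bounded_clinear S \<and>
    (\<forall>t::real. surj_isometry (exp_op (\<lambda>x. (\<i> * of_real t) *\<^sub>C S x)))"

section \<open>The Zygmund space and the little Zygmund space\<close>

text \<open>A function on the open unit disc is represented by its extension by \<open>0\<close> to the whole
  plane, so that equality of functions is equality on the disc.\<close>

definition zygmund :: "(complex \<Rightarrow> complex) set"
  where "zygmund = {f.
    (\<forall>z. z \<notin> ball 0 1 \<longrightarrow> f z = 0) \<and>
    f holomorphic_on ball 0 1 \<and>
    (\<exists>g. continuous_on (cball 0 1) g \<and> (\<forall>z\<in>ball 0 1. g z = f z)) \<and>
    bdd_above ((\<lambda>z. (1 - (cmod z)\<^sup>2) * cmod ((deriv ^^ 2) f z)) ` ball 0 1)}"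

definition zygmund_norm :: "(complex \<Rightarrow> complex) \<Rightarrow> real"
  where "zygmund_norm f = cmod (f 0) + cmod (deriv f 0) +
    (SUP z\<in>ball 0 1. (1 - (cmod z)\<^sup>2) * cmod ((deriv ^^ 2) f z))"

definition little_zygmund :: "(complex \<Rightarrow> complex) set"
  where "little_zygmund = {f \<in> zygmund.
    ((\<lambda>z. (1 - (cmod z)\<^sup>2) * cmod ((deriv ^^ 2) f z)) \<longlongrightarrow> 0)
      (filtercomap cmod (at_left 1))}"

lemma zygmundD:
  assumes "f \<in> zygmund"
  shows "z \<notin> ball 0 1 \<Longrightarrow> f z = 0"
    and "f holomorphic_on ball 0 1"
    and "uniformly_continuous_on (ball 0 1) f"
    and "bdd_above ((\<lambda>z. (1 - (cmod z)\<^sup>2) * cmod ((deriv ^^ 2) f z)) ` ball 0 1)"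
proof -
  show "z \<notin> ball 0 1 \<Longrightarrow> f z = 0" "f holomorphic_on ball 0 1"
    "bdd_above ((\<lambda>z. (1 - (cmod z)\<^sup>2) * cmod ((deriv ^^ 2) f z)) ` ball 0 1)"
    using assms by (simp_all add: zygmund_def)
  obtain g where g: "continuous_on (cball 0 1) g" "\<forall>z\<in>ball 0 1. g z = f z"
    using assms unfolding zygmund_def by blast
  have "uniformly_continuous_on (cball 0 1) g"
    by (rule compact_uniformly_continuous[OF g(1) compact_cball])
  then have "uniformly_continuous_on (ball 0 1) g"
    unfolding uniformly_continuous_on_def by (meson ball_subset_cball subsetD)
  then show "uniformly_continuous_on (ball 0 1) f"
    using g(2) by (simp add: uniformly_continuous_on_def)
qed

lemma zygmundI:
  assumes "\<And>z. z \<notin> ball 0 1 \<Longrightarrow> f z = 0"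
    and "f holomorphic_on ball 0 1"
    and "uniformly_continuous_on (ball 0 1) f"
    and "\<And>z. z \<in> ball 0 1 \<Longrightarrow> (1 - (cmod z)\<^sup>2) * cmod ((deriv ^^ 2) f z) \<le> M"
  shows "f \<in> zygmund"
proof -
  obtain g where "uniformly_continuous_on (closure (ball 0 1)) g"
    and fg: "\<And>z. z \<in> ball 0 1 \<Longrightarrow> f z = g z"
    by (rule uniformly_continuous_on_extension_on_closure[OF assms(3)]) (rule that, simp_all)
  then have "continuous_on (cball 0 1) g"
    using uniformly_continuous_imp_continuous[of "closure (ball 0 1)" g] by simp
  moreover have "bdd_above ((\<lambda>z. (1 - (cmod z)\<^sup>2) * cmod ((deriv ^^ 2) f z)) ` ball 0 1)"
    by (rule bdd_aboveI2) (rule assms(4))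
  ultimately show ?thesis
    unfolding zygmund_def mem_Collect_eq using assms(1,2) fg by metis
qed

lemma disc_weight_pos: "z \<in> ball 0 1 \<Longrightarrow> 0 < 1 - (cmod z)\<^sup>2"
  by (simp add: abs_square_less_1)

lemma zygmund_weight_le:
  assumes "f \<in> zygmund" "z \<in> ball 0 1"
  shows "(1 - (cmod z)\<^sup>2) * cmod ((deriv ^^ 2) f z)
    \<le> (SUP z\<in>ball 0 1. (1 - (cmod z)\<^sup>2) * cmod ((deriv ^^ 2) f z))"
  using assms(2) zygmundD(4)[OF assms(1)] by (rule cSUP_upper)

lemma zygmund_sup_nonneg:
  assumes "f \<in> zygmund"
  shows "0 \<le> (SUP z\<in>ball 0 1. (1 - (cmod z)\<^sup>2) * cmod ((deriv ^^ 2) f z))"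
proof -
  have "0 \<le> (1 - (cmod 0)\<^sup>2) * cmod ((deriv ^^ 2) f 0)" by simp
  also have "\<dots> \<le> (SUP z\<in>ball 0 1. (1 - (cmod z)\<^sup>2) * cmod ((deriv ^^ 2) f z))"
    by (rule zygmund_weight_le[OF assms]) simp
  finally show ?thesis .
qed

lemma zygmund_weight_le_norm:
  assumes "f \<in> zygmund" "z \<in> ball 0 1"
  shows "(1 - (cmod z)\<^sup>2) * cmod ((deriv ^^ 2) f z) \<le> zygmund_norm f"
proof -
  have "0 \<le> cmod (f 0)" "0 \<le> cmod (deriv f 0)" by simp_all
  then show ?thesis
    using zygmund_weight_le[OF assms] unfolding zygmund_norm_def by linarith
qed

lemma tendsto_zero_boundary_le:
  assumes "(f \<longlongrightarrow> 0) (filtercomap cmod (at_left 1))"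
    and "\<And>z. z \<in> ball 0 1 \<Longrightarrow> norm (g z) \<le> f z"
  shows "(g \<longlongrightarrow> 0) (filtercomap cmod (at_left 1))"
proof (rule Lim_null_comparison[OF _ assms(1)])
  have "eventually (\<lambda>r::real. r < 1) (at_left 1)"
    by (simp add: eventually_at_filter)
  then have "eventually (\<lambda>z. cmod z < 1) (filtercomap cmod (at_left 1))"
    by (rule eventually_filtercomapI)
  then show "eventually (\<lambda>z. norm (g z) \<le> f z) (filtercomap cmod (at_left 1))"
    by eventually_elim (use assms(2) in simp)
qed

lemma zygmund_weight_add_le:
  assumes "f \<in> zygmund" "g \<in> zygmund" "z \<in> ball 0 1"
  shows "(1 - (cmod z)\<^sup>2) * cmod ((deriv ^^ 2) (\<lambda>z. f z + g z) z)
    \<le> (1 - (cmod z)\<^sup>2) * cmod ((deriv ^^ 2) f z) + (1 - (cmod z)\<^sup>2) * cmod ((deriv ^^ 2) g z)"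
proof -
  have "(deriv ^^ 2) (\<lambda>z. f z + g z) z = (deriv ^^ 2) f z + (deriv ^^ 2) g z"
    by (rule higher_deriv_add[OF zygmundD(2)[OF assms(1)] zygmundD(2)[OF assms(2)] open_ball assms(3)])
  then have "(1 - (cmod z)\<^sup>2) * cmod ((deriv ^^ 2) (\<lambda>z. f z + g z) z)
    \<le> (1 - (cmod z)\<^sup>2) * (cmod ((deriv ^^ 2) f z) + cmod ((deriv ^^ 2) g z))"
    using disc_weight_pos[OF assms(3)]
    by (simp add: norm_triangle_ineq)
  then show ?thesis by (simp only: distrib_left)
qed

lemma zygmund_weight_cmult:
  assumes "f \<in> zygmund" "z \<in> ball 0 1"
  shows "(1 - (cmod z)\<^sup>2) * cmod ((deriv ^^ 2) (\<lambda>z. c * f z) z)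
    = cmod c * ((1 - (cmod z)\<^sup>2) * cmod ((deriv ^^ 2) f z))"
  using higher_deriv_cmult[OF zygmundD(2)[OF assms(1)] assms(2) open_ball, of 2 c]
  by (simp only: norm_mult mult_ac)

lemma zygmund_add:
  assumes "f \<in> zygmund" "g \<in> zygmund"
  shows "(\<lambda>z. f z + g z) \<in> zygmund"
proof (rule zygmundI)
  fix z :: complex assume z: "z \<in> ball 0 1"
  show "(1 - (cmod z)\<^sup>2) * cmod ((deriv ^^ 2) (\<lambda>z. f z + g z) z) \<le> zygmund_norm f + zygmund_norm g"
    using zygmund_weight_add_le[OF assms z] zygmund_weight_le_norm[OF assms(1) z]
      zygmund_weight_le_norm[OF assms(2) z] by linarith
next
  show "(\<lambda>z. f z + g z) holomorphic_on ball 0 1"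
    using zygmundD(2)[OF assms(1)] zygmundD(2)[OF assms(2)] by (rule holomorphic_on_add)
  show "uniformly_continuous_on (ball 0 1) (\<lambda>z. f z + g z)"
    using zygmundD(3)[OF assms(1)] zygmundD(3)[OF assms(2)] by (rule uniformly_continuous_on_add)
  show "f z + g z = 0" if "z \<notin> ball 0 1" for z
    using zygmundD(1)[OF assms(1) that] zygmundD(1)[OF assms(2) that] by simp
qed

lemma zygmund_cmult:
  assumes "f \<in> zygmund"
  shows "(\<lambda>z. c * f z) \<in> zygmund"
proof (rule zygmundI)
  fix z :: complex assume z: "z \<in> ball 0 1"
  show "(1 - (cmod z)\<^sup>2) * cmod ((deriv ^^ 2) (\<lambda>z. c * f z) z) \<le> cmod c * zygmund_norm f"
    unfolding zygmund_weight_cmult[OF assms z]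
    using zygmund_weight_le_norm[OF assms z] by (rule mult_left_mono) simp
next
  show "(\<lambda>z. c * f z) holomorphic_on ball 0 1"
    using holomorphic_on_const zygmundD(2)[OF assms] by (rule holomorphic_on_mult)
  show "uniformly_continuous_on (ball 0 1) (\<lambda>z. c * f z)"
    using bounded_linear_mult_right zygmundD(3)[OF assms]
    by (rule bounded_linear.uniformly_continuous_on)
  show "c * f z = 0" if "z \<notin> ball 0 1" for z
    using zygmundD(1)[OF assms that] by simp
qed

lemma zygmund_norm_add:
  assumes "f \<in> zygmund" "g \<in> zygmund"
  shows "zygmund_norm (\<lambda>z. f z + g z) \<le> zygmund_norm f + zygmund_norm g"
proof -
  have "(SUP z\<in>ball 0 1. (1 - (cmod z)\<^sup>2) * cmod ((deriv ^^ 2) (\<lambda>z. f z + g z) z))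
    \<le> (SUP z\<in>ball 0 1. (1 - (cmod z)\<^sup>2) * cmod ((deriv ^^ 2) f z)) +
      (SUP z\<in>ball 0 1. (1 - (cmod z)\<^sup>2) * cmod ((deriv ^^ 2) g z))"
  proof (rule cSUP_least)
    fix z :: complex assume z: "z \<in> ball 0 1"
    show "(1 - (cmod z)\<^sup>2) * cmod ((deriv ^^ 2) (\<lambda>z. f z + g z) z)
      \<le> (SUP z\<in>ball 0 1. (1 - (cmod z)\<^sup>2) * cmod ((deriv ^^ 2) f z)) +
        (SUP z\<in>ball 0 1. (1 - (cmod z)\<^sup>2) * cmod ((deriv ^^ 2) g z))"
      using zygmund_weight_add_le[OF assms z] zygmund_weight_le[OF assms(1) z]
        zygmund_weight_le[OF assms(2) z] by linarith
  qed simp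
  moreover have "deriv (\<lambda>z. f z + g z) 0 = deriv f 0 + deriv g 0"
    using higher_deriv_add[OF zygmundD(2)[OF assms(1)] zygmundD(2)[OF assms(2)] open_ball, of 0 1]
    by simp
  then have "cmod (deriv (\<lambda>z. f z + g z) 0) \<le> cmod (deriv f 0) + cmod (deriv g 0)"
    by (simp add: norm_triangle_ineq)
  moreover have "cmod (f 0 + g 0) \<le> cmod (f 0) + cmod (g 0)"
    by (rule norm_triangle_ineq)
  ultimately show ?thesis
    unfolding zygmund_norm_def by linarith
qed

lemma zygmund_norm_cmult:
  assumes "f \<in> zygmund"
  shows "zygmund_norm (\<lambda>z. c * f z) = cmod c * zygmund_norm f"
proof -
  have le: "zygmund_norm (\<lambda>z. c * f z) \<le> cmod c * zygmund_norm f" if f: "f \<in> zygmund" for c f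
  proof -
    have "(SUP z\<in>ball 0 1. (1 - (cmod z)\<^sup>2) * cmod ((deriv ^^ 2) (\<lambda>z. c * f z) z))
      \<le> cmod c * (SUP z\<in>ball 0 1. (1 - (cmod z)\<^sup>2) * cmod ((deriv ^^ 2) f z))"
    proof (rule cSUP_least)
      fix z :: complex assume z: "z \<in> ball 0 1"
      show "(1 - (cmod z)\<^sup>2) * cmod ((deriv ^^ 2) (\<lambda>z. c * f z) z)
        \<le> cmod c * (SUP z\<in>ball 0 1. (1 - (cmod z)\<^sup>2) * cmod ((deriv ^^ 2) f z))"
        unfolding zygmund_weight_cmult[OF f z]
        using zygmund_weight_le[OF f z] by (rule mult_left_mono) simp
    qed simp
    moreover have "deriv (\<lambda>z. c * f z) 0 = c * deriv f 0"
      using higher_deriv_cmult[OF zygmundD(2)[OF f] _ open_ball, of 0 1 c] by simp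
    ultimately show ?thesis
      unfolding zygmund_norm_def by (simp add: norm_mult distrib_left)
  qed
  show ?thesis
  proof (cases "c = 0")
    case True
    then show ?thesis
      by (simp add: zygmund_norm_def)
  next
    case False
    have "zygmund_norm (\<lambda>z. inverse c * (c * f z)) \<le> cmod (inverse c) * zygmund_norm (\<lambda>z. c * f z)"
      by (rule le[OF zygmund_cmult[OF assms]])
    also have "(\<lambda>z. inverse c * (c * f z)) = f"
      using False by auto
    finally have "cmod c * zygmund_norm f \<le> zygmund_norm (\<lambda>z. c * f z)"
      using False by (simp add: norm_divide field_simps)
    then show ?thesis
      using le[OF assms] by (simp add: antisym)
  qed
qed

lemma little_zygmund_add:
  assumes "f \<in> little_zygmund" "g \<in> little_zygmund"
  shows "(\<lambda>z. f z + g z) \<in> little_zygmund"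
proof -
  have Z: "f \<in> zygmund" "g \<in> zygmund"
    using assms by (auto simp: little_zygmund_def)
  have "((\<lambda>z. (1 - (cmod z)\<^sup>2) * cmod ((deriv ^^ 2) f z) + (1 - (cmod z)\<^sup>2) * cmod ((deriv ^^ 2) g z)) \<longlongrightarrow> 0)
      (filtercomap cmod (at_left 1))"
    using tendsto_add[of _ 0 _ _ 0] assms unfolding little_zygmund_def by fastforce
  then have "((\<lambda>z. (1 - (cmod z)\<^sup>2) * cmod ((deriv ^^ 2) (\<lambda>z. f z + g z) z)) \<longlongrightarrow> 0)
      (filtercomap cmod (at_left 1))"
  proof (rule tendsto_zero_boundary_le)
    fix z :: complex assume z: "z \<in> ball 0 1"
    show "norm ((1 - (cmod z)\<^sup>2) * cmod ((deriv ^^ 2) (\<lambda>z. f z + g z) z))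
      \<le> (1 - (cmod z)\<^sup>2) * cmod ((deriv ^^ 2) f z) + (1 - (cmod z)\<^sup>2) * cmod ((deriv ^^ 2) g z)"
      using zygmund_weight_add_le[OF Z z] disc_weight_pos[OF z] by (simp add: abs_mult)
  qed
  then show ?thesis
    using zygmund_add[OF Z] by (simp add: little_zygmund_def)
qed

lemma little_zygmund_cmult:
  assumes "f \<in> little_zygmund"
  shows "(\<lambda>z. c * f z) \<in> little_zygmund"
proof -
  have Z: "f \<in> zygmund"
    using assms by (auto simp: little_zygmund_def)
  have "((\<lambda>z. cmod c * ((1 - (cmod z)\<^sup>2) * cmod ((deriv ^^ 2) f z))) \<longlongrightarrow> 0)
      (filtercomap cmod (at_left 1))"
    using tendsto_mult_right_zero assms unfolding little_zygmund_def by blast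
  then have "((\<lambda>z. (1 - (cmod z)\<^sup>2) * cmod ((deriv ^^ 2) (\<lambda>z. c * f z) z)) \<longlongrightarrow> 0)
      (filtercomap cmod (at_left 1))"
  proof (rule tendsto_zero_boundary_le)
    fix z :: complex assume z: "z \<in> ball 0 1"
    show "norm ((1 - (cmod z)\<^sup>2) * cmod ((deriv ^^ 2) (\<lambda>z. c * f z) z))
      \<le> cmod c * ((1 - (cmod z)\<^sup>2) * cmod ((deriv ^^ 2) f z))"
      unfolding zygmund_weight_cmult[OF Z z] using disc_weight_pos[OF z] by (simp add: abs_mult)
  qed
  then show ?thesis
    using zygmund_cmult[OF Z] by (simp add: little_zygmund_def)
qed

lemma zero_little_zygmund: "(\<lambda>z. 0) \<in> little_zygmund"
proof -
  have "(deriv ^^ 2) (\<lambda>z::complex. 0::complex) = (\<lambda>z. 0)"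
    by (simp add: numeral_2_eq_2)
  then have "(\<lambda>z. 0) \<in> zygmund"
    by (intro zygmundI[where M = 0]) (auto simp: uniformly_continuous_on_const)
  then show ?thesis
    by (simp add: little_zygmund_def numeral_2_eq_2)
qed

lemma zygmund_sup_bound:
  assumes f: "f \<in> zygmund" and z: "z \<in> ball 0 1"
  shows "cmod (f z) \<le> zygmund_norm f"
proof (cases "z = 0")
  case True
  then show ?thesis
    using zygmund_sup_nonneg[OF f] by (simp add: zygmund_norm_def)
next
  case False
  define M where "M = (SUP z\<in>ball 0 1. (1 - (cmod z)\<^sup>2) * cmod ((deriv ^^ 2) f z))"
  have M0: "0 \<le> M"
    using zygmund_sup_nonneg[OF f] by (simp add: M_def)
  define u where "u = sgn z"
  define r where "r = cmod z"
  have u: "cmod u = 1" and zr: "z = of_real r * u" and r: "0 < r" "r < 1"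
    using False z by (auto simp: u_def r_def norm_sgn sgn_eq norm_divide)
  have hol: "f holomorphic_on ball 0 1"
    using zygmundD(2)[OF f] .
  have hol': "deriv f holomorphic_on ball 0 1"
    using hol holomorphic_deriv open_ball by blast
  have inb: "of_real t * u \<in> ball 0 1" if "0 \<le> t" "t < 1" for t
    using that u by (simp add: norm_mult)
  have der: "((\<lambda>t. f (of_real t * u)) has_vector_derivative u * deriv f (of_real t * u)) (at t)"
    if "0 \<le> t" "t < 1" for t
  proof -
    have "(f has_field_derivative deriv f (of_real t * u)) (at (of_real t * u))"
      using hol inb[OF that] holomorphic_derivI open_ball by blast
    then have "((\<lambda>w. f (w * u)) has_field_derivative deriv f (of_real t * u) * u) (at (of_real t))"
      by (rule DERIV_chain2) (auto intro!: derivative_eq_intros)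
    then show ?thesis
      using has_vector_derivative_real_field by (fastforce simp: mult.commute)
  qed
  have der': "((\<lambda>t. deriv f (of_real t * u)) has_vector_derivative u * (deriv ^^ 2) f (of_real t * u)) (at t)"
    if "0 \<le> t" "t < 1" for t
  proof -
    have "(deriv f has_field_derivative (deriv ^^ 2) f (of_real t * u)) (at (of_real t * u))"
      using holomorphic_derivI[OF hol' open_ball inb[OF that]] by (simp add: numeral_2_eq_2)
    then have "((\<lambda>w. deriv f (w * u)) has_field_derivative (deriv ^^ 2) f (of_real t * u) * u) (at (of_real t))"
      by (rule DERIV_chain2) (auto intro!: derivative_eq_intros)
    then show ?thesis
      using has_vector_derivative_real_field by (fastforce simp: mult.commute)
  qed
  have b2: "cmod ((deriv ^^ 2) f (of_real t * u)) \<le> M / (1 - t)" if "0 \<le> t" "t < 1" for t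
  proof -
    have "(1 - t\<^sup>2) * cmod ((deriv ^^ 2) f (of_real t * u)) \<le> M"
      using zygmund_weight_le[OF f inb[OF that]] u that by (simp add: M_def norm_mult)
    moreover have "(1 - t) * cmod ((deriv ^^ 2) f (of_real t * u))
        \<le> (1 - t\<^sup>2) * cmod ((deriv ^^ 2) f (of_real t * u))"
    proof (rule mult_right_mono)
      show "1 - t \<le> 1 - t\<^sup>2" using that by (simp add: power2_eq_square mult_left_le)
    qed simp
    ultimately show ?thesis using that by (simp add: field_simps)
  qed
  have cont: "continuous_on {0..s} (\<lambda>t. f (of_real t * u))"
    "continuous_on {0..s} (\<lambda>t. deriv f (of_real t * u))" if "s < 1" for s
    using that by (intro continuous_at_imp_continuous_on ballI
        has_vector_derivative_continuous[OF der] has_vector_derivative_continuous[OF der']; simp)+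
  have b1: "cmod (deriv f (of_real s * u)) \<le> cmod (deriv f 0) - M * ln (1 - s)" if s: "0 < s" "s < 1" for s
  proof -
    have "norm (deriv f (of_real s * u) - deriv f (of_real 0 * u)) \<le> - M * ln (1 - s) - (- M * ln (1 - 0))"
    proof (rule differentiable_bound_general[where f = "\<lambda>t. deriv f (of_real t * u)"
          and \<phi> = "\<lambda>t. - M * ln (1 - t)" and f' = "\<lambda>t. u * (deriv ^^ 2) f (of_real t * u)"
          and \<phi>' = "\<lambda>t. M / (1 - t)"])
      show "continuous_on {0..s} (\<lambda>t. - M * ln (1 - t))"
        using s by (intro continuous_intros) auto
      show "((\<lambda>t. - M * ln (1 - t)) has_vector_derivative M / (1 - t)) (at t)" if "0 < t" "t < s" for t
        using that s by (auto intro!: derivative_eq_intros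
            simp flip: has_real_derivative_iff_has_vector_derivative)
      show "norm (u * (deriv ^^ 2) f (of_real t * u)) \<le> M / (1 - t)" if "0 < t" "t < s" for t
        using that s b2[of t] by (simp add: norm_mult u)
    qed (use s cont der' in auto)
    then have "cmod (deriv f (of_real s * u) - deriv f 0) \<le> - M * ln (1 - s)" by simp
    then show ?thesis
      using norm_triangle_ineq2[of "deriv f (of_real s * u)" "deriv f 0"] by linarith
  qed
  have "norm (f (of_real r * u) - f (of_real 0 * u))
    \<le> (cmod (deriv f 0) * r + M * ((1 - r) * ln (1 - r) + r))
      - (cmod (deriv f 0) * 0 + M * ((1 - 0) * ln (1 - 0) + 0))"
  proof (rule differentiable_bound_general[where f = "\<lambda>t. f (of_real t * u)"
        and \<phi> = "\<lambda>t. cmod (deriv f 0) * t + M * ((1 - t) * ln (1 - t) + t)"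
        and f' = "\<lambda>t. u * deriv f (of_real t * u)"
        and \<phi>' = "\<lambda>t. cmod (deriv f 0) - M * ln (1 - t)"])
    show "continuous_on {0..r} (\<lambda>t. cmod (deriv f 0) * t + M * ((1 - t) * ln (1 - t) + t))"
      using r by (intro continuous_intros) auto
    show "((\<lambda>t. cmod (deriv f 0) * t + M * ((1 - t) * ln (1 - t) + t))
        has_vector_derivative cmod (deriv f 0) - M * ln (1 - t)) (at t)" if "0 < t" "t < r" for t
    proof -
      have "M + M * t / (1 - t) = M / (1 - t)"
        using that r by (simp add: field_simps)
      then show ?thesis
        using that r by (auto intro!: derivative_eq_intros
            simp: algebra_simps simp flip: has_real_derivative_iff_has_vector_derivative)
    qed
    show "norm (u * deriv f (of_real t * u)) \<le> cmod (deriv f 0) - M * ln (1 - t)"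
      if "0 < t" "t < r" for t
      using that r b1[of t] by (simp add: norm_mult u)
  qed (use r cont der in auto)
  then have *: "cmod (f z - f 0) \<le> cmod (deriv f 0) * r + M * ((1 - r) * ln (1 - r) + r)"
    by (simp add: zr)
  have "(1 - r) * ln (1 - r) \<le> 0"
    using r by (simp add: mult_nonneg_nonpos)
  then have "(1 - r) * ln (1 - r) + r \<le> 1" using r by linarith
  then have "M * ((1 - r) * ln (1 - r) + r) \<le> M * 1"
    by (rule mult_left_mono[OF _ M0])
  moreover have "cmod (deriv f 0) * r \<le> cmod (deriv f 0)"
    using r by (simp add: mult_left_le)
  ultimately show ?thesis
    using * norm_triangle_ineq2[of "f z" "f 0"] by (simp add: zygmund_norm_def M_def)
qed

typedef zygmund0 = little_zygmund
  using zero_little_zygmund by blast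

setup_lifting type_definition_zygmund0

text \<open>\<open>Rep_zygmund0 f z\<close> is the value \<open>f(z)\<close>.\<close>

instantiation zygmund0 :: real_normed_vector
begin

lift_definition zero_zygmund0 :: zygmund0 is "\<lambda>z. 0"
  by (rule zero_little_zygmund)

lift_definition plus_zygmund0 :: "zygmund0 \<Rightarrow> zygmund0 \<Rightarrow> zygmund0" is "\<lambda>f g z. f z + g z"
  by (rule little_zygmund_add)

lift_definition uminus_zygmund0 :: "zygmund0 \<Rightarrow> zygmund0" is "\<lambda>f z. - f z"
  using little_zygmund_cmult[of _ "-1"] by simp

lift_definition minus_zygmund0 :: "zygmund0 \<Rightarrow> zygmund0 \<Rightarrow> zygmund0" is "\<lambda>f g z. f z - g z"
  using little_zygmund_add[OF _ little_zygmund_cmult[of _ "-1"]] by simp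

lift_definition scaleR_zygmund0 :: "real \<Rightarrow> zygmund0 \<Rightarrow> zygmund0" is "\<lambda>r f z. of_real r * f z"
  by (rule little_zygmund_cmult)

lift_definition norm_zygmund0 :: "zygmund0 \<Rightarrow> real" is zygmund_norm .

definition "dist_zygmund0 (f :: zygmund0) g = norm (f - g)"

definition "sgn_zygmund0 (f :: zygmund0) = scaleR (inverse (norm f)) f"

definition "(uniformity :: (zygmund0 \<times> zygmund0) filter) = (INF e\<in>{0<..}. principal {(x, y). dist x y < e})"

definition "open_zygmund0 (U :: zygmund0 set) = (\<forall>x\<in>U. \<forall>\<^sub>F (x', y) in uniformity. x' = x \<longrightarrow> y \<in> U)"

instance
proof
  fix f g h :: zygmund0 and a b :: real
  show "f + g + h = f + (g + h)" by transfer (simp add: add.assoc)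
  show "f + g = g + f" by transfer (simp add: add.commute)
  show "0 + f = f" by transfer simp
  show "- f + f = 0" by transfer simp
  show "f - g = f + - g" by transfer simp
  show "a *\<^sub>R (f + g) = a *\<^sub>R f + a *\<^sub>R g" by transfer (simp add: distrib_left)
  show "(a + b) *\<^sub>R f = a *\<^sub>R f + b *\<^sub>R f" by transfer (simp add: distrib_right)
  show "a *\<^sub>R b *\<^sub>R f = (a * b) *\<^sub>R f" by transfer (simp add: mult.assoc)
  show "1 *\<^sub>R f = f" by transfer simp
  show "dist f g = norm (f - g)" by (rule dist_zygmund0_def)
  show "sgn f = scaleR (inverse (norm f)) f" by (rule sgn_zygmund0_def)
  show "(uniformity :: (zygmund0 \<times> zygmund0) filter) = (INF e\<in>{0<..}. principal {(x, y). dist x y < e})"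
    by (rule uniformity_zygmund0_def)
  show "open U \<longleftrightarrow> (\<forall>x\<in>U. \<forall>\<^sub>F (x', y) in uniformity. x' = x \<longrightarrow> y \<in> U)" for U :: "zygmund0 set"
    by (rule open_zygmund0_def)
  show "norm f = 0 \<longleftrightarrow> f = 0"
  proof transfer
    fix f assume "f \<in> little_zygmund"
    then have f: "f \<in> zygmund" by (simp add: little_zygmund_def)
    show "zygmund_norm f = 0 \<longleftrightarrow> f = (\<lambda>z. 0)"
    proof
      assume "zygmund_norm f = 0"
      then show "f = (\<lambda>z. 0)"
        using zygmund_sup_bound[OF f] zygmundD(1)[OF f] by (metis norm_le_zero_iff)
    qed (simp add: zygmund_norm_def numeral_2_eq_2)
  qed
  show "norm (f + g) \<le> norm f + norm g"
    by transfer (auto simp: little_zygmund_def intro: zygmund_norm_add)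
  show "norm (a *\<^sub>R f) = \<bar>a\<bar> * norm f"
    by transfer (auto simp: little_zygmund_def zygmund_norm_cmult)
qed

end

instantiation zygmund0 :: complex_normed_vector
begin

lift_definition scaleC_zygmund0 :: "complex \<Rightarrow> zygmund0 \<Rightarrow> zygmund0" is "\<lambda>c f z. c * f z"
  by (rule little_zygmund_cmult)

instance
proof
  fix f g :: zygmund0 and a b :: complex and r :: real
  show "a *\<^sub>C (f + g) = a *\<^sub>C f + a *\<^sub>C g" by transfer (simp add: distrib_left)
  show "(a + b) *\<^sub>C f = a *\<^sub>C f + b *\<^sub>C f" by transfer (simp add: distrib_right)
  show "a *\<^sub>C b *\<^sub>C f = (a * b) *\<^sub>C f" by transfer (simp add: mult.assoc)
  show "1 *\<^sub>C f = f" by transfer simp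
  show "r *\<^sub>R f = of_real r *\<^sub>C f" by transfer simp
  show "norm (a *\<^sub>C f) = cmod a * norm f"
    by transfer (auto simp: little_zygmund_def zygmund_norm_cmult)
qed

end

instance zygmund0 :: complex_banach
proof
  fix X :: "nat \<Rightarrow> zygmund0"
  assume X: "Cauchy X"
  define F where "F n = Rep_zygmund0 (X n)" for n
  have F: "F n \<in> little_zygmund" for n
    by (simp add: F_def Rep_zygmund0)
  have Z: "F n \<in> zygmund" for n
    using F by (simp add: little_zygmund_def)
  have hol: "F n holomorphic_on ball 0 1" for n
    using zygmundD(2)[OF Z] .
  have dF: "(\<lambda>z. F m z - F n z) \<in> zygmund" for m n
    using zygmund_add[OF Z[of m] zygmund_cmult[OF Z[of n], of "-1"]] by simp
  have dist: "dist (X m) (X n) = zygmund_norm (\<lambda>z. F m z - F n z)" for m n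
    unfolding dist_zygmund0_def F_def by transfer simp
  have "uniformly_Cauchy_on (ball 0 1) F"
  proof (rule uniformly_Cauchy_onI)
    fix e :: real assume "e > 0"
    then obtain M where M: "\<forall>m\<ge>M. \<forall>n\<ge>M. dist (X m) (X n) < e"
      using X by (auto simp: Cauchy_def)
    have "dist (F m z) (F n z) < e" if "z \<in> ball 0 1" "m \<ge> M" "n \<ge> M" for z m n
      using zygmund_sup_bound[OF dF that(1), of m n] M that dist[of m n]
      by (fastforce simp: dist_norm)
    then show "\<exists>M. \<forall>x\<in>ball 0 1. \<forall>m\<ge>M. \<forall>n\<ge>M. dist (F m x) (F n x) < e" by blast
  qed
  then obtain g0 where g0: "uniform_limit (ball 0 1) F g0 sequentially"
    using Cauchy_uniformly_convergent unfolding uniformly_convergent_on_def by blast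
  define g where "g z = (if z \<in> ball 0 1 then g0 z else 0)" for z
  have lim: "uniform_limit (ball 0 1) F g sequentially"
    by (rule uniform_limit_cong'[THEN iffD1, OF _ _ g0]) (auto simp: g_def)
  have ghol: "g holomorphic_on ball 0 1"
  proof (rule holomorphic_uniform_sequence[OF open_ball hol])
    fix x :: complex assume "x \<in> ball 0 1"
    then obtain d where "d > 0" "cball x d \<subseteq> ball 0 1"
      using open_contains_cball open_ball by blast
    then show "\<exists>d>0. cball x d \<subseteq> ball 0 1 \<and> uniform_limit (cball x d) F g sequentially"
      using uniform_limit_on_subset[OF lim] by blast
  qed
  have ldF: "(\<lambda>n. (deriv ^^ k) (F n) z) \<longlonglongrightarrow> (deriv ^^ k) g z" if "z \<in> ball 0 1" for k z
    by (rule higher_deriv_complex_uniform_limit[OF lim _ _ open_ball that]) (auto simp: hol)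
  have guc: "uniformly_continuous_on (ball 0 1) g"
    unfolding uniformly_continuous_on_def
  proof (intro allI impI)
    fix e :: real assume e: "e > 0"
    have "\<forall>\<^sub>F n in sequentially. \<forall>x\<in>ball 0 1. dist (F n x) (g x) < e / 3"
      by (rule uniform_limitD[OF lim]) (use e in simp)
    then obtain n where n: "\<forall>x\<in>ball 0 1. dist (F n x) (g x) < e / 3"
      unfolding eventually_sequentially by blast
    obtain d where d: "d > 0" "\<forall>x\<in>ball 0 1. \<forall>x'\<in>ball 0 1. dist x' x < d \<longrightarrow> dist (F n x') (F n x) < e / 3"
      using zygmundD(3)[OF Z[of n], unfolded uniformly_continuous_on_def, rule_format, of "e / 3"] e
      by auto
    have "dist (g x') (g x) < e" if "x \<in> ball 0 1" "x' \<in> ball 0 1" "dist x' x < d" for x x'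
    proof -
      have "dist (F n x') (F n x) < e / 3" "dist (F n x') (g x') < e / 3" "dist (F n x) (g x) < e / 3"
        using n d that by blast+
      moreover have "dist (g x') (g x) \<le> dist (F n x') (g x') + dist (F n x') (F n x) + dist (F n x) (g x)"
        using dist_triangle[of "g x'" "g x" "F n x'"] dist_triangle[of "F n x'" "g x" "F n x"]
        by (simp add: dist_commute)
      ultimately show ?thesis by linarith
    qed
    then show "\<exists>d>0. \<forall>x\<in>ball 0 1. \<forall>x'\<in>ball 0 1. dist x' x < d \<longrightarrow> dist (g x') (g x) < e"
      using d(1) by blast
  qed
  have unif: "\<exists>N. \<forall>n\<ge>N. cmod (F n 0 - g 0) \<le> e \<and> cmod (deriv (F n) 0 - deriv g 0) \<le> e \<and>
      (\<forall>z\<in>ball 0 1. (1 - (cmod z)\<^sup>2) * cmod ((deriv ^^ 2) (F n) z - (deriv ^^ 2) g z) \<le> e)"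
    if e: "e > 0" for e
  proof -
    obtain M where M: "\<forall>m\<ge>M. \<forall>n\<ge>M. dist (X m) (X n) < e"
      using X e by (auto simp: Cauchy_def)
    have norm_le: "zygmund_norm (\<lambda>z. F n z - F m z) \<le> e" if "m \<ge> M" "n \<ge> M" for m n
      using M that dist[of n m] by force
    have hd: "(deriv ^^ k) (\<lambda>z. F n z - F m z) z = (deriv ^^ k) (F n) z - (deriv ^^ k) (F m) z"
      if "z \<in> ball 0 1" for k m n z
      by (rule higher_deriv_diff[OF hol hol open_ball that])
    show ?thesis
    proof (intro exI[of _ M] allI impI conjI ballI)
      fix n assume n: "n \<ge> M"
      have "cmod (F n 0 - F m 0) \<le> e" if "m \<ge> M" for m
        using zygmund_sup_bound[OF dF, of 0 n m] norm_le[OF that n] by simp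
      then have "\<forall>\<^sub>F m in sequentially. cmod (F n 0 - F m 0) \<le> e"
        by (rule eventually_sequentiallyI)
      moreover have "(\<lambda>m. cmod (F n 0 - F m 0)) \<longlonglongrightarrow> cmod (F n 0 - g 0)"
        using ldF[of 0 0] by (intro tendsto_intros) auto
      ultimately show "cmod (F n 0 - g 0) \<le> e"
        by (rule tendsto_upperbound[OF _ _ sequentially_bot, rotated])
      have "cmod (deriv (F n) 0 - deriv (F m) 0) \<le> e" if "m \<ge> M" for m
      proof -
        have "cmod (deriv (\<lambda>z. F n z - F m z) 0) \<le> zygmund_norm (\<lambda>z. F n z - F m z)"
          using zygmund_sup_nonneg[OF dF, of n m] by (simp add: zygmund_norm_def)
        then show ?thesis
          using hd[of 0 1 n m] norm_le[OF that n] by simp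
      qed
      then have "\<forall>\<^sub>F m in sequentially. cmod (deriv (F n) 0 - deriv (F m) 0) \<le> e"
        by (rule eventually_sequentiallyI)
      moreover have "(\<lambda>m. cmod (deriv (F n) 0 - deriv (F m) 0)) \<longlonglongrightarrow> cmod (deriv (F n) 0 - deriv g 0)"
        using ldF[of 0 1] by (intro tendsto_intros) auto
      ultimately show "cmod (deriv (F n) 0 - deriv g 0) \<le> e"
        by (rule tendsto_upperbound[OF _ _ sequentially_bot, rotated])
      fix z :: complex assume z: "z \<in> ball 0 1"
      have "(1 - (cmod z)\<^sup>2) * cmod ((deriv ^^ 2) (F n) z - (deriv ^^ 2) (F m) z) \<le> e" if "m \<ge> M" for m
        using zygmund_weight_le_norm[OF dF z, of n m] norm_le[OF that n] hd[OF z, of 2 n m] by simp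
      then have "\<forall>\<^sub>F m in sequentially.
          (1 - (cmod z)\<^sup>2) * cmod ((deriv ^^ 2) (F n) z - (deriv ^^ 2) (F m) z) \<le> e"
        by (rule eventually_sequentiallyI)
      moreover have "(\<lambda>m. (1 - (cmod z)\<^sup>2) * cmod ((deriv ^^ 2) (F n) z - (deriv ^^ 2) (F m) z))
          \<longlonglongrightarrow> (1 - (cmod z)\<^sup>2) * cmod ((deriv ^^ 2) (F n) z - (deriv ^^ 2) g z)"
        using ldF[OF z, of 2] by (intro tendsto_intros) auto
      ultimately show "(1 - (cmod z)\<^sup>2) * cmod ((deriv ^^ 2) (F n) z - (deriv ^^ 2) g z) \<le> e"
        by (rule tendsto_upperbound[OF _ _ sequentially_bot, rotated])
    qed
  qed
  have wg: "(1 - (cmod z)\<^sup>2) * cmod ((deriv ^^ 2) g z) \<le> (1 - (cmod z)\<^sup>2) * cmod ((deriv ^^ 2) (F n) z)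
      + (1 - (cmod z)\<^sup>2) * cmod ((deriv ^^ 2) (F n) z - (deriv ^^ 2) g z)"
    if "z \<in> ball 0 1" for z n
  proof -
    have "cmod ((deriv ^^ 2) g z)
        \<le> cmod ((deriv ^^ 2) (F n) z) + cmod ((deriv ^^ 2) (F n) z - (deriv ^^ 2) g z)"
      using norm_triangle_sub[of "(deriv ^^ 2) g z" "(deriv ^^ 2) (F n) z"]
      by (simp add: norm_minus_commute)
    then have "(1 - (cmod z)\<^sup>2) * cmod ((deriv ^^ 2) g z) \<le> (1 - (cmod z)\<^sup>2) *
        (cmod ((deriv ^^ 2) (F n) z) + cmod ((deriv ^^ 2) (F n) z - (deriv ^^ 2) g z))"
      using disc_weight_pos[OF that] by (intro mult_left_mono) auto
    then show ?thesis by (simp only: distrib_left)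
  qed
  have gZ: "g \<in> zygmund"
  proof -
    obtain n where n: "\<forall>z\<in>ball 0 1. (1 - (cmod z)\<^sup>2) * cmod ((deriv ^^ 2) (F n) z - (deriv ^^ 2) g z) \<le> 1"
      using unif[of 1] by auto
    show ?thesis
    proof (rule zygmundI[OF _ ghol guc])
      show "(1 - (cmod z)\<^sup>2) * cmod ((deriv ^^ 2) g z) \<le> zygmund_norm (F n) + 1"
        if "z \<in> ball 0 1" for z
        using wg[OF that, of n] n that zygmund_weight_le_norm[OF Z[of n] that] by fastforce
    qed (auto simp: g_def)
  qed
  have inside: "\<forall>\<^sub>F z in filtercomap cmod (at_left 1). z \<in> ball 0 1"
  proof -
    have "eventually (\<lambda>r::real. r < 1) (at_left 1)"
      by (simp add: eventually_at_filter)
    then have "eventually (\<lambda>z. cmod z < 1) (filtercomap cmod (at_left 1))"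
      by (rule eventually_filtercomapI)
    then show ?thesis by simp
  qed
  have gL: "g \<in> little_zygmund"
  proof -
    have "((\<lambda>z. (1 - (cmod z)\<^sup>2) * cmod ((deriv ^^ 2) g z)) \<longlongrightarrow> 0) (filtercomap cmod (at_left 1))"
    proof (rule tendstoI)
      fix e :: real assume e: "e > 0"
      obtain n where n: "\<forall>z\<in>ball 0 1. (1 - (cmod z)\<^sup>2) * cmod ((deriv ^^ 2) (F n) z - (deriv ^^ 2) g z) \<le> e / 2"
        using unif[of "e / 2"] e by auto
      have "((\<lambda>z. (1 - (cmod z)\<^sup>2) * cmod ((deriv ^^ 2) (F n) z)) \<longlongrightarrow> 0) (filtercomap cmod (at_left 1))"
        using F[of n] by (simp add: little_zygmund_def)
      then have "\<forall>\<^sub>F z in filtercomap cmod (at_left 1).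
          dist ((1 - (cmod z)\<^sup>2) * cmod ((deriv ^^ 2) (F n) z)) 0 < e / 2"
        using e by (intro tendstoD) auto
      then show "\<forall>\<^sub>F z in filtercomap cmod (at_left 1).
          dist ((1 - (cmod z)\<^sup>2) * cmod ((deriv ^^ 2) g z)) 0 < e"
        using inside
      proof eventually_elim
        case (elim z)
        have "(1 - (cmod z)\<^sup>2) * cmod ((deriv ^^ 2) (F n) z) < e / 2"
          using elim(1) by (simp add: dist_real_def)
        moreover have "(1 - (cmod z)\<^sup>2) * cmod ((deriv ^^ 2) (F n) z - (deriv ^^ 2) g z) \<le> e / 2"
          using n elim(2) by blast
        ultimately have "(1 - (cmod z)\<^sup>2) * cmod ((deriv ^^ 2) g z) < e"
          using wg[OF elim(2), of n] by linarith
        moreover have "0 \<le> (1 - (cmod z)\<^sup>2) * cmod ((deriv ^^ 2) g z)"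
          using disc_weight_pos[OF elim(2)] by simp
        ultimately show ?case by (simp add: dist_real_def)
      qed
    qed
    then show ?thesis using gZ by (simp add: little_zygmund_def)
  qed
  define G where "G = Abs_zygmund0 g"
  have G: "Rep_zygmund0 G = g"
    by (simp add: G_def Abs_zygmund0_inverse gL)
  have distG: "dist (X n) G = zygmund_norm (\<lambda>z. F n z - g z)" for n
    unfolding dist_zygmund0_def F_def G[symmetric] by transfer simp
  have "X \<longlonglongrightarrow> G"
    unfolding lim_sequentially
  proof (intro allI impI)
    fix e :: real assume e: "e > 0"
    obtain N where N: "\<forall>n\<ge>N. cmod (F n 0 - g 0) \<le> e / 4 \<and> cmod (deriv (F n) 0 - deriv g 0) \<le> e / 4 \<and>
        (\<forall>z\<in>ball 0 1. (1 - (cmod z)\<^sup>2) * cmod ((deriv ^^ 2) (F n) z - (deriv ^^ 2) g z) \<le> e / 4)"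
      using unif[of "e / 4"] e by auto
    have "dist (X n) G < e" if "n \<ge> N" for n
    proof -
      have hd: "(deriv ^^ k) (\<lambda>z. F n z - g z) z = (deriv ^^ k) (F n) z - (deriv ^^ k) g z"
        if "z \<in> ball 0 1" for k z
        by (rule higher_deriv_diff[OF hol ghol open_ball that])
      have "(SUP z\<in>ball 0 1. (1 - (cmod z)\<^sup>2) * cmod ((deriv ^^ 2) (\<lambda>z. F n z - g z) z)) \<le> e / 4"
      proof (rule cSUP_least)
        show "(1 - (cmod z)\<^sup>2) * cmod ((deriv ^^ 2) (\<lambda>z. F n z - g z) z) \<le> e / 4"
          if "z \<in> ball 0 1" for z
          using N \<open>n \<ge> N\<close> that hd[OF that, of 2] by metis
      qed simp
      moreover have "cmod (deriv (\<lambda>z. F n z - g z) 0) \<le> e / 4"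
        using hd[of 0 1] N that by simp
      moreover have "cmod (F n 0 - g 0) \<le> e / 4"
        using N that by blast
      ultimately show ?thesis
        unfolding distG zygmund_norm_def using e by linarith
    qed
    then show "\<exists>no. \<forall>n\<ge>no. dist (X n) G < e" by blast
  qed
  then show "convergent X"
    by (rule convergentI)
qed

end

theory Submission
  imports Defs
begin

text \<open>The map sending \<open>f\<close> to \<open>(f(0), f'(0), f'')\<close> embeds the little Zygmund space into an
  \<open>\<ell>\<^sup>1\<close>-sum, so functionals of norm at most 1 that attain the norm at \<open>f\<close> are explicit. For such a
  functional \<open>\<phi>\<close>, differentiating \<open>|\<phi>(exp(itS) f)| \<le> \<parallel>f\<parallel>\<close> at \<open>t = 0\<close> shows that \<open>\<phi>(Sf)\<close> is real.
  The freedom in choosing unimodular coefficients decouples the three summands.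
  On the third one, the function with \<open>g'' = (1 - |w|\<^sup>2) / (1 - cnj w z)\<^sup>2\<close> attains its norm at \<open>w\<close>,
  and still does after adding a small complex multiple of any \<open>f\<close> with \<open>f''\<close> vanishing doubly at
  \<open>w\<close>; hence \<open>(Sf)''(w) = 0\<close> for these \<open>f\<close>, that is \<open>(Sf)'' = a f'' + G f'''\<close> with \<open>a\<close>, \<open>G\<close>
  holomorphic. Testing with \<open>h'' = (z - w) / (1 - cnj w z)\<^sup>3\<close>, boundedness of \<open>S\<close> gives
  \<open>|G(w)| \<le> \<parallel>S\<parallel> (1 - |w|\<^sup>2)\<close>, so \<open>G = 0\<close> by the maximum principle, and \<open>a\<close> is real-valued,
  hence constant.\<close>

section \<open>Support functionals of hermitian operators\<close>

lemma hermitian_support: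
  fixes S :: "'a::complex_banach \<Rightarrow> 'a" and \<phi> :: "'a \<Rightarrow> complex"
  assumes S: "bounded_hermitian S"
    and add: "\<And>x y. \<phi> (x + y) = \<phi> x + \<phi> y"
    and scale: "\<And>c x. \<phi> (c *\<^sub>C x) = c * \<phi> x"
    and le: "\<And>x. cmod (\<phi> x) \<le> norm x"
    and x: "\<phi> x = norm x"
  shows "Im (\<phi> (S x)) = 0"
proof -
  have bl: "bounded_linear S" and SC: "\<And>c x. S (c *\<^sub>C x) = c *\<^sub>C S x"
    using S by (auto simp: bounded_hermitian_def bounded_clinear_def)
  obtain B where B: "0 < B" "\<And>x. norm (S x) \<le> norm x * B"
    using bounded_linear.pos_bounded[OF bl] by blast
  define T where "T t y = (\<i> * of_real t) *\<^sub>C S y" for t :: real and y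
  have Tn: "norm ((T t ^^ n) y) \<le> (\<bar>t\<bar> * B) ^ n * norm y" for t :: real and n y
  proof (induction n)
    case (Suc n)
    have "norm ((T t ^^ Suc n) y) \<le> \<bar>t\<bar> * (norm ((T t ^^ n) y) * B)"
      using B by (simp add: T_def norm_scaleC norm_mult mult_left_mono)
    also have "\<dots> = (\<bar>t\<bar> * B) * norm ((T t ^^ n) y)" by simp
    also have "\<dots> \<le> (\<bar>t\<bar> * B) * ((\<bar>t\<bar> * B) ^ n * norm y)"
      using B Suc by (intro mult_left_mono) auto
    finally show ?case by (simp add: mult_ac)
  qed simp
  \<comment> \<open>Differentiation at \<open>t = 0\<close> in quantitative form: the exponential
    preserves \<open>norm x\<close> and \<open>\<phi> x\<close> is real, so the real part of the
    first-order term, \<open>- (t * Im (\<phi> (S x)))\<close>, is at most the norm of the remainder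
    of order two.\<close>
  have bnd1: "- (t * Im (\<phi> (S x))) \<le> t\<^sup>2 * (exp B * norm x)" if t: "\<bar>t\<bar> \<le> 1" for t :: real
  proof -
    define e where "e n = (T t ^^ n) x /\<^sub>R fact n" for n
    have en: "norm (e n) \<le> (B ^ n /\<^sub>R fact n) * norm x" for n
    proof -
      have "norm (e n) \<le> (\<bar>t\<bar> * B) ^ n * norm x / fact n"
        unfolding e_def using Tn[of n t x] by (simp add: divide_simps)
      also have "\<dots> \<le> B ^ n * norm x / fact n"
        using t B by (intro divide_right_mono mult_right_mono power_mono) (auto simp: mult_left_le_one_le)
      finally show ?thesis by (simp add: divide_inverse mult_ac)
    qed
    have sB: "summable (\<lambda>n. B ^ n /\<^sub>R fact n * norm x)"
      by (intro summable_mult2 summable_exp_generic)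
    have se: "summable e"
      by (rule summable_comparison_test'[OF sB en])
    \<comment> \<open>From index 2 on a factor \<open>t\<^sup>2\<close> splits off, and
      \<open>\<bar>t\<bar> \<le> 1\<close> absorbs the other powers, so the remaining constant does
      not depend on \<open>t\<close>.\<close>
    have "norm (e (n + 2)) \<le> t\<^sup>2 * ((B ^ (n + 2) /\<^sub>R fact (n + 2)) * norm x)" for n
    proof -
      have "norm (e (n + 2)) \<le> (\<bar>t\<bar> * B) ^ (n + 2) * norm x / fact (n + 2)"
        unfolding e_def using Tn[of "n + 2" t x] by (simp add: divide_simps)
      also have "\<dots> = t\<^sup>2 * (\<bar>t\<bar> ^ n * (B ^ (n + 2) * norm x / fact (n + 2)))"
        by (simp add: power_mult_distrib power_add power2_eq_square)
      also have "\<dots> \<le> t\<^sup>2 * (1 * (B ^ (n + 2) * norm x / fact (n + 2)))"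
        using t B by (intro mult_left_mono mult_right_mono power_le_one) auto
      finally show ?thesis by (simp add: divide_inverse mult_ac)
    qed
    then have "norm (\<Sum>n. e (n + 2)) \<le> (\<Sum>n. t\<^sup>2 * ((B ^ (n + 2) /\<^sub>R fact (n + 2)) * norm x))"
      by (intro norm_suminf_le summable_mult summable_ignore_initial_segment[OF sB])
    also have "\<dots> = t\<^sup>2 * (\<Sum>n. (B ^ (n + 2) /\<^sub>R fact (n + 2)) * norm x)"
      by (intro suminf_mult summable_ignore_initial_segment[OF sB])
    also have "\<dots> \<le> t\<^sup>2 * (exp B * norm x)"
    proof (rule mult_left_mono)
      have "(\<Sum>n. (B ^ (n + 2) /\<^sub>R fact (n + 2)) * norm x)
          = (\<Sum>n. (B ^ n /\<^sub>R fact n) * norm x) - (\<Sum>n<2. (B ^ n /\<^sub>R fact n) * norm x)"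
        by (rule suminf_minus_initial_segment[OF sB])
      also have "\<dots> \<le> (\<Sum>n. (B ^ n /\<^sub>R fact n) * norm x)"
        using B by (simp add: sum_nonneg)
      also have "\<dots> = exp B * norm x"
        using suminf_mult2[OF summable_exp_generic[of B]] by (simp add: exp_def)
      finally show "(\<Sum>n. (B ^ (n + 2) /\<^sub>R fact (n + 2)) * norm x) \<le> exp B * norm x" .
    qed simp
    finally have rem: "norm (\<Sum>n. e (n + 2)) \<le> t\<^sup>2 * (exp B * norm x)" .
    define R where "R = (\<Sum>n. e (n + 2))"
    have U: "exp_op (T t) x = x + T t x + R"
    proof -
      have "exp_op (T t) x = R + sum e {..<2}"
        using suminf_split_initial_segment[OF se, of 2] by (simp only: exp_op_def R_def e_def[abs_def])
      also have "sum e {..<2} = x + T t x"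
        by (simp add: e_def numeral_2_eq_2)
      finally show ?thesis by (simp add: add_ac)
    qed
    \<comment> \<open>\<open>surj_isometry\<close> speaks of distances; preservation of the norm
      follows because the exponential fixes 0.\<close>
    have z0: "(T t ^^ n) 0 = 0" for n
      using Tn[of n t 0] by simp
    have "surj_isometry (exp_op (T t))"
      using S unfolding bounded_hermitian_def T_def by blast
    then have "dist (exp_op (T t) x) (exp_op (T t) 0) = dist x 0"
      by (simp add: surj_isometry_def)
    then have "norm (x + T t x + R) = norm x"
      by (simp add: U) (simp add: exp_op_def z0)
    then have "cmod (\<phi> x + \<i> * of_real t * \<phi> (S x) + \<phi> R) \<le> norm x"
      using le[of "x + T t x + R"] by (simp add: add T_def scale)
    then have "Re (\<phi> x + \<i> * of_real t * \<phi> (S x) + \<phi> R) \<le> norm x"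
      using complex_Re_le_cmod order_trans by blast
    then have "- (t * Im (\<phi> (S x))) \<le> - Re (\<phi> R)"
      by (simp add: x)
    also have "\<dots> \<le> norm R"
      using abs_Re_le_cmod[of "\<phi> R"] le[of R] by linarith
    also have "\<dots> \<le> t\<^sup>2 * (exp B * norm x)"
      using rem by (simp add: R_def)
    finally show ?thesis .
  qed
  \<comment> \<open>Applying the estimate to both \<open>t\<close> and \<open>- t\<close> controls
    the absolute value.\<close>
  have bnd: "t * \<bar>Im (\<phi> (S x))\<bar> \<le> t\<^sup>2 * (exp B * norm x)" if "0 \<le> t" "t \<le> 1" for t
    using bnd1[of t] bnd1[of "- t"] that by (simp add: abs_if)
  show ?thesis
  proof (rule ccontr)
    define K where "K = exp B * norm x"
    assume *: "Im (\<phi> (S x)) \<noteq> 0"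
    have K: "0 \<le> K" by (simp add: K_def)
    \<comment> \<open>Chosen so that \<open>t * K\<close> is strictly below
      \<open>\<bar>Im (\<phi> (S x))\<bar>\<close>; adding 1 makes the quotient defined when
      \<open>K = 0\<close> and the inequality strict.\<close>
    define t where "t = min 1 (\<bar>Im (\<phi> (S x))\<bar> / (K + 1))"
    have t: "0 < t" "t \<le> 1" using * K by (auto simp: t_def)
    have "t * \<bar>Im (\<phi> (S x))\<bar> \<le> t * (t * K)"
      using bnd[of t] t by (simp add: K_def power2_eq_square mult_ac)
    then have "\<bar>Im (\<phi> (S x))\<bar> \<le> t * K" using t by simp
    also have "t * K \<le> \<bar>Im (\<phi> (S x))\<bar> / (K + 1) * K"
      using K by (intro mult_right_mono) (auto simp: t_def)
    also have "\<dots> < \<bar>Im (\<phi> (S x))\<bar>"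
      using K * by (simp add: field_simps)
    finally show False by simp
  qed
qed

section \<open>The three components of a function and the norm\<close>

definition d0 :: "zygmund0 \<Rightarrow> complex"
  where "d0 f = Rep_zygmund0 f 0"

definition d1 :: "zygmund0 \<Rightarrow> complex"
  where "d1 f = deriv (Rep_zygmund0 f) 0"

text \<open>Meaningful on the open disc only: elsewhere it is an iterated \<open>deriv\<close> of
  the extension by 0, hence the restriction to \<open>ball 0 1\<close> in the rules below.\<close>

definition d2 :: "zygmund0 \<Rightarrow> complex \<Rightarrow> complex"
  where "d2 f = (deriv ^^ 2) (Rep_zygmund0 f)"

lemma Rep_zygmund0_zygmund: "Rep_zygmund0 f \<in> zygmund"
  using Rep_zygmund0[of f] by (simp add: little_zygmund_def)

lemma Rep_zygmund0_holomorphic: "Rep_zygmund0 f holomorphic_on ball 0 1"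
  by (rule zygmundD(2)[OF Rep_zygmund0_zygmund])

lemma d2_holomorphic: "d2 f holomorphic_on ball 0 1"
  unfolding d2_def by (rule holomorphic_higher_deriv[OF Rep_zygmund0_holomorphic open_ball])

lemma Rep_zygmund0_add: "Rep_zygmund0 (f + g) = (\<lambda>z. Rep_zygmund0 f z + Rep_zygmund0 g z)"
  by (rule plus_zygmund0.rep_eq)

lemma Rep_zygmund0_scaleC: "Rep_zygmund0 (c *\<^sub>C f) = (\<lambda>z. c * Rep_zygmund0 f z)"
  by (rule scaleC_zygmund0.rep_eq)

lemma jet_add:
  "d0 (f + g) = d0 f + d0 g"
  "d1 (f + g) = d1 f + d1 g"
  "z \<in> ball 0 1 \<Longrightarrow> d2 (f + g) z = d2 f z + d2 g z"
  using higher_deriv_add[OF Rep_zygmund0_holomorphic[of f] Rep_zygmund0_holomorphic[of g] open_ball, of 0 1]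
    higher_deriv_add[OF Rep_zygmund0_holomorphic[of f] Rep_zygmund0_holomorphic[of g] open_ball, of z 2]
  by (simp_all add: d0_def d1_def d2_def Rep_zygmund0_add)

lemma jet_scaleC:
  "d0 (c *\<^sub>C f) = c * d0 f"
  "d1 (c *\<^sub>C f) = c * d1 f"
  "z \<in> ball 0 1 \<Longrightarrow> d2 (c *\<^sub>C f) z = c * d2 f z"
  using higher_deriv_cmult[OF Rep_zygmund0_holomorphic[of f] _ open_ball, of 0 1 c]
    higher_deriv_cmult[OF Rep_zygmund0_holomorphic[of f] _ open_ball, of z 2 c]
  by (simp_all add: d0_def d1_def d2_def Rep_zygmund0_scaleC)

text \<open>The dual of an l1-sum carries the maximum norm, so the three coefficients range
  independently over the closed unit disc. The value 0 switches a component off.\<close>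

lemma jet_functional_le_norm:
  assumes "cmod \<mu> \<le> 1" "cmod \<nu> \<le> 1" "cmod \<kappa> \<le> 1" "w \<in> ball 0 1"
  shows "cmod (\<mu> * d0 f + \<nu> * d1 f + \<kappa> * of_real (1 - (cmod w)\<^sup>2) * d2 f w) \<le> norm f"
proof -
  define M where "M = (SUP z\<in>ball 0 1. (1 - (cmod z)\<^sup>2) * cmod ((deriv ^^ 2) (Rep_zygmund0 f) z))"
  have w: "0 < 1 - (cmod w)\<^sup>2" by (rule disc_weight_pos[OF assms(4)])
  have "cmod (\<kappa> * of_real (1 - (cmod w)\<^sup>2) * d2 f w) = cmod \<kappa> * ((1 - (cmod w)\<^sup>2) * cmod (d2 f w))"
    using w by (simp only: norm_mult norm_of_real mult.assoc abs_of_pos)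
  also have "\<dots> \<le> 1 * ((1 - (cmod w)\<^sup>2) * cmod (d2 f w))"
    using w assms by (intro mult_right_mono) auto
  also have "\<dots> \<le> M"
    using zygmund_weight_le[OF Rep_zygmund0_zygmund assms(4)] by (simp add: M_def d2_def)
  finally have 2: "cmod (\<kappa> * of_real (1 - (cmod w)\<^sup>2) * d2 f w) \<le> M" .
  have "cmod (\<mu> * d0 f) \<le> cmod (d0 f)" "cmod (\<nu> * d1 f) \<le> cmod (d1 f)"
    using assms by (simp_all add: norm_mult mult_left_le_one_le)
  moreover have "norm f = cmod (d0 f) + cmod (d1 f) + M"
    by (simp add: norm_zygmund0.rep_eq zygmund_norm_def d0_def d1_def M_def)
  ultimately show ?thesis
    using 2 norm_triangle_ineq[of "\<mu> * d0 f + \<nu> * d1 f" "\<kappa> * of_real (1 - (cmod w)\<^sup>2) * d2 f w"]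
      norm_triangle_ineq[of "\<mu> * d0 f" "\<nu> * d1 f"] by linarith
qed

lemma zygmund0_weight_le_norm:
  assumes "w \<in> ball 0 1"
  shows "(1 - (cmod w)\<^sup>2) * cmod (d2 f w) \<le> norm f"
  using zygmund_weight_le_norm[OF Rep_zygmund0_zygmund assms] by (simp add: norm_zygmund0.rep_eq d2_def)

lemma zygmund0_norm_le:
  assumes "\<And>z. z \<in> ball 0 1 \<Longrightarrow> (1 - (cmod z)\<^sup>2) * cmod (d2 f z) \<le> M"
  shows "norm f \<le> cmod (d0 f) + cmod (d1 f) + M"
proof -
  have "(SUP z\<in>ball 0 1. (1 - (cmod z)\<^sup>2) * cmod ((deriv ^^ 2) (Rep_zygmund0 f) z)) \<le> M"
    using assms by (intro cSUP_least) (auto simp: d2_def)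
  then show ?thesis
    by (simp add: norm_zygmund0.rep_eq zygmund_norm_def d0_def d1_def)
qed

lemma hermitian_support_zygmund0:
  assumes S: "bounded_hermitian S"
    and "cmod \<mu> \<le> 1" "cmod \<nu> \<le> 1" "cmod \<kappa> \<le> 1" "w \<in> ball 0 1"
    and "\<mu> * d0 f + \<nu> * d1 f + \<kappa> * of_real (1 - (cmod w)\<^sup>2) * d2 f w = norm f"
  shows "Im (\<mu> * d0 (S f) + \<nu> * d1 (S f) + \<kappa> * of_real (1 - (cmod w)\<^sup>2) * d2 (S f) w) = 0"
proof (rule hermitian_support[OF S, where \<phi> = "\<lambda>f. \<mu> * d0 f + \<nu> * d1 f + \<kappa> * of_real (1 - (cmod w)\<^sup>2) * d2 f w"])
  show "cmod (\<mu> * d0 x + \<nu> * d1 x + \<kappa> * of_real (1 - (cmod w)\<^sup>2) * d2 x w) \<le> norm x" for x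
    by (rule jet_functional_le_norm[OF assms(2-5)])
qed (use assms(5,6) in \<open>simp_all only: jet_add jet_scaleC distrib_left distrib_right mult_ac add_ac\<close>)

text \<open>The difference has norm 0, so identities in the space can be checked component by
  component.\<close>

lemma zygmund0_eqI:
  assumes "d0 f = d0 g" "d1 f = d1 g" "\<And>z. z \<in> ball 0 1 \<Longrightarrow> d2 f z = d2 g z"
  shows "f = g"
proof -
  define h where "h = f + (-1) *\<^sub>C g"
  have "norm h \<le> cmod (d0 h) + cmod (d1 h) + 0"
    by (rule zygmund0_norm_le) (simp add: h_def jet_add jet_scaleC assms)
  then have "h = 0"
    by (simp add: h_def jet_add jet_scaleC assms)
  have "(-1) *\<^sub>C g = - g"
    using scaleR_scaleC[of "-1" g] by simp
  with \<open>h = 0\<close> show ?thesis by (simp add: h_def)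
qed

section \<open>Construction of test functions and attainment of the norm\<close>

text \<open>On the closed unit disc, compact in the larger disc, \<open>F''\<close> is bounded, so
  the weight alone forces the decay at the boundary that the little space demands.\<close>

lemma zygmund0_of_holomorphic:
  assumes F: "F holomorphic_on ball 0 R" and R: "1 < R"
  obtains f where "\<And>z. z \<in> ball 0 1 \<Longrightarrow> Rep_zygmund0 f z = F z"
    "d0 f = F 0" "d1 f = deriv F 0" "\<And>z. z \<in> ball 0 1 \<Longrightarrow> d2 f z = (deriv ^^ 2) F z"
proof -
  define g where "g z = (if z \<in> ball 0 1 then F z else 0)" for z
  have sub: "cball 0 1 \<subseteq> ball (0::complex) R" using R by auto
  have sub': "ball 0 1 \<subseteq> ball (0::complex) R" using R by auto
  have F1: "F holomorphic_on ball 0 1" by (rule holomorphic_on_subset[OF F sub'])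
  have hg: "g holomorphic_on ball 0 1"
    by (rule holomorphic_transform[OF F1]) (simp add: g_def)
  have dg: "(deriv ^^ n) g z = (deriv ^^ n) F z" if "z \<in> ball 0 1" for n z
    by (rule higher_deriv_transform_within_open[OF hg F1 open_ball that]) (simp add: g_def)
  have "continuous_on (cball 0 1) ((deriv ^^ 2) F)"
    by (meson F open_ball holomorphic_higher_deriv holomorphic_on_imp_continuous_on
        holomorphic_on_subset sub)
  then have "compact ((deriv ^^ 2) F ` cball 0 1)"
    by (intro compact_continuous_image) auto
  then obtain M where M: "\<And>z. z \<in> cball 0 1 \<Longrightarrow> cmod ((deriv ^^ 2) F z) \<le> M"
    using compact_imp_bounded[of "(deriv ^^ 2) F ` cball 0 1"] unfolding bounded_iff by blast
  have w: "(1 - (cmod z)\<^sup>2) * cmod ((deriv ^^ 2) g z) \<le> (1 - (cmod z)\<^sup>2) * M" if "z \<in> ball 0 1" for z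
    using dg[OF that, of 2] M[of z] that disc_weight_pos[OF that] by (intro mult_left_mono) auto
  have M0: "0 \<le> M" using M[of 0] norm_ge_zero order_trans by (metis centre_in_cball zero_le_one)
  have gz: "g \<in> zygmund"
  proof (rule zygmundI[OF _ hg])
    show "g z = 0" if "z \<notin> ball 0 1" for z using that by (simp add: g_def)
    have "uniformly_continuous_on (cball 0 1) F"
      by (intro compact_uniformly_continuous holomorphic_on_imp_continuous_on
          holomorphic_on_subset[OF F sub]) auto
    then have "uniformly_continuous_on (ball 0 1) F"
      unfolding uniformly_continuous_on_def by (meson ball_subset_cball subsetD)
    then show "uniformly_continuous_on (ball 0 1) g"
      by (simp add: uniformly_continuous_on_def g_def)
    show "(1 - (cmod z)\<^sup>2) * cmod ((deriv ^^ 2) g z) \<le> M" if "z \<in> ball 0 1" for z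
      using w[OF that] mult_right_mono[of "1 - (cmod z)\<^sup>2" 1 M] M0 by simp
  qed
  have "((\<lambda>r::real. (1 - r\<^sup>2) * M) \<longlongrightarrow> (1 - 1\<^sup>2) * M) (at_left 1)"
    by (intro tendsto_intros)
  then have "((\<lambda>z. (1 - (cmod z)\<^sup>2) * M) \<longlongrightarrow> 0) (filtercomap cmod (at_left 1))"
    using filterlim_compose[OF _ filterlim_filtercomap] by fastforce
  then have "((\<lambda>z. (1 - (cmod z)\<^sup>2) * cmod ((deriv ^^ 2) g z)) \<longlongrightarrow> 0) (filtercomap cmod (at_left 1))"
  proof (rule tendsto_zero_boundary_le)
    show "norm ((1 - (cmod z)\<^sup>2) * cmod ((deriv ^^ 2) g z)) \<le> (1 - (cmod z)\<^sup>2) * M" if "z \<in> ball 0 1" for z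
      using w[OF that] disc_weight_pos[OF that] by (simp add: abs_mult)
  qed
  then have "g \<in> little_zygmund" using gz by (simp add: little_zygmund_def)
  then have r: "Rep_zygmund0 (Abs_zygmund0 g) = g" by (rule Abs_zygmund0_inverse)
  show ?thesis
    by (rule that[of "Abs_zygmund0 g"]) (use dg[of 0 1] dg[of _ 2] in \<open>auto simp: d0_def d1_def d2_def r g_def\<close>)
qed

text \<open>Two integrations, normalised at 0, prescribe the second derivative without initial
  values; both stay on the disc of radius \<open>R > 1\<close>, so the primitive lies in the little
  space.\<close>

lemma second_primitive:
  assumes g: "g holomorphic_on ball 0 R" and R: "1 < R"
  obtains f where "d0 f = 0" "d1 f = 0" "\<And>z. z \<in> ball 0 1 \<Longrightarrow> d2 f z = g z"
proof -
  obtain G where G: "\<And>z. z \<in> ball 0 R \<Longrightarrow> (G has_field_derivative g z) (at z)"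
    using holomorphic_convex_primitive'[OF convex_ball open_ball g] at_within_open[OF _ open_ball] by metis
  have hG: "(\<lambda>z. G z - G 0) holomorphic_on ball 0 R"
    by (intro holomorphic_intros holomorphic_onI) (meson G field_differentiable_at_within field_differentiable_def)
  obtain F where F: "\<And>z. z \<in> ball 0 R \<Longrightarrow> (F has_field_derivative G z - G 0) (at z)"
    using holomorphic_convex_primitive'[OF convex_ball open_ball hG] at_within_open[OF _ open_ball] by metis
  have hF: "(\<lambda>z. F z - F 0) holomorphic_on ball 0 R"
    by (intro holomorphic_intros holomorphic_onI) (meson F field_differentiable_at_within field_differentiable_def)
  have dF: "deriv (\<lambda>z. F z - F 0) z = G z - G 0" if "z \<in> ball 0 R" for z
    by (rule DERIV_imp_deriv) (auto intro!: derivative_eq_intros F[OF that])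
  have "(deriv ^^ 2) (\<lambda>z. F z - F 0) z = g z" if "z \<in> ball 0 R" for z
  proof -
    have "(deriv ^^ 2) (\<lambda>z. F z - F 0) z = deriv (deriv (\<lambda>z. F z - F 0)) z"
      by (simp add: numeral_2_eq_2)
    also have "\<dots> = deriv (\<lambda>z. G z - G 0) z"
      by (rule complex_derivative_transform_within_open[OF holomorphic_deriv[OF hF open_ball] hG open_ball that dF])
    also have "\<dots> = g z"
      by (rule DERIV_imp_deriv) (auto intro!: derivative_eq_intros G[OF that])
    finally show ?thesis .
  qed
  moreover obtain f where "d0 f = F 0 - F 0" "d1 f = deriv (\<lambda>z. F z - F 0) 0"
    "\<And>z. z \<in> ball 0 1 \<Longrightarrow> d2 f z = (deriv ^^ 2) (\<lambda>z. F z - F 0) z"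
    using zygmund0_of_holomorphic[OF hF R] by metis
  ultimately show ?thesis using that[of f] dF[of 0] R by simp
qed

lemma constant_zygmund0:
  obtains e where "\<And>z. z \<in> ball 0 1 \<Longrightarrow> Rep_zygmund0 e z = 1"
    "d0 e = 1" "d1 e = 0" "\<And>z. z \<in> ball 0 1 \<Longrightarrow> d2 e z = 0"
proof (rule zygmund0_of_holomorphic[of "\<lambda>_. 1" 2])
  fix f
  assume "\<And>z. z \<in> ball 0 1 \<Longrightarrow> Rep_zygmund0 f z = 1" "d0 f = 1" "d1 f = deriv (\<lambda>_. 1) 0"
    "\<And>z. z \<in> ball 0 1 \<Longrightarrow> d2 f z = (deriv ^^ 2) (\<lambda>_. 1) z"
  then show thesis
    by (intro that[of f]) (simp_all add: numeral_2_eq_2)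
qed simp_all

lemma identity_zygmund0:
  obtains e where "\<And>z. z \<in> ball 0 1 \<Longrightarrow> Rep_zygmund0 e z = z"
    "d0 e = 0" "d1 e = 1" "\<And>z. z \<in> ball 0 1 \<Longrightarrow> d2 e z = 0"
proof (rule zygmund0_of_holomorphic[of "\<lambda>z. z" 2])
  fix f
  assume "\<And>z. z \<in> ball 0 1 \<Longrightarrow> Rep_zygmund0 f z = z" "d0 f = 0" "d1 f = deriv (\<lambda>z. z) 0"
    "\<And>z. z \<in> ball 0 1 \<Longrightarrow> d2 f z = (deriv ^^ 2) (\<lambda>z. z) z"
  then show thesis
    by (intro that[of f]) (simp_all add: numeral_2_eq_2)
qed simp_all

text \<open>Here the little space matters: the weighted modulus tends to 0 at the boundary, so its
  supremum is reached on a compact smaller disc.\<close>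

lemma zygmund0_norm_attained:
  assumes "d0 f = 0" "d1 f = 0"
  obtains w where "w \<in> ball 0 1" "norm f = (1 - (cmod w)\<^sup>2) * cmod (d2 f w)"
proof (cases "norm f = 0")
  case True
  then have "(1 - (cmod 0)\<^sup>2) * cmod (d2 f 0) \<le> 0"
    using zygmund0_weight_le_norm[of 0 f] by simp
  then show ?thesis using that[of 0] True by simp
next
  case False
  define v where "v z = (1 - (cmod z)\<^sup>2) * cmod (d2 f z)" for z
  have "(v \<longlongrightarrow> 0) (filtercomap cmod (at_left 1))"
    using Rep_zygmund0[of f] by (simp add: little_zygmund_def v_def[abs_def] d2_def)
  then have "eventually (\<lambda>z. dist (v z) 0 < norm f / 2) (filtercomap cmod (at_left 1))"
    using False by (intro tendstoD) auto
  then obtain P where P: "eventually P (at_left (1::real))" "\<And>z. P (cmod z) \<Longrightarrow> \<bar>v z\<bar> < norm f / 2"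
    unfolding eventually_filtercomap by auto
  obtain b where b: "b < 1" "\<And>r. b < r \<Longrightarrow> r < 1 \<Longrightarrow> P r"
    using P(1) eventually_at_left[of 0 "1::real"] by auto
  \<comment> \<open>\<open>b\<close> may be negative; the maximum with 0 keeps
    \<open>cball 0 r\<close> nonempty.\<close>
  define r where "r = max 0 b"
  have out: "v z \<le> norm f / 2" if "r < cmod z" "cmod z < 1" for z
    using b P(2)[of z] that by (force simp: r_def)
  have r: "0 \<le> r" "r < 1" using b by (auto simp: r_def)
  have "continuous_on (ball 0 1) v"
    unfolding v_def by (intro continuous_intros holomorphic_on_imp_continuous_on d2_holomorphic)
  then have "continuous_on (cball 0 r) v"
    by (rule continuous_on_subset) (use r in auto)
  moreover have "cball (0::complex) r \<noteq> {}" using r by auto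
  ultimately obtain w where w: "w \<in> cball 0 r" "\<And>z. z \<in> cball 0 r \<Longrightarrow> v z \<le> v w"
    using continuous_attains_sup[of "cball 0 r" v] by auto
  have w1: "w \<in> ball 0 1" using w r by auto
  \<comment> \<open>Outside \<open>cball 0 r\<close> the weighted modulus is at most half of the
    nonzero norm, so the maximum has to be \<open>v w\<close>.\<close>
  have "norm f \<le> cmod (d0 f) + cmod (d1 f) + max (norm f / 2) (v w)"
    by (rule zygmund0_norm_le) (metis w(2) out dist_0_norm linorder_not_less max.coboundedI1 max.coboundedI2 mem_ball mem_cball v_def)
  then have "norm f \<le> v w" using assms False by (auto simp: max_def split: if_splits)
  then show ?thesis
    using that[OF w1] zygmund0_weight_le_norm[OF w1, of f] by (simp add: v_def)
qed

section \<open>Disc geometry, double zeros and perturbed peak functions\<close>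

text \<open>Dividing by the left side expresses 1 minus the squared pseudo-hyperbolic distance of
  \<open>z\<close> and \<open>w\<close>. Both families of test functions are estimated with
  it.\<close>

lemma moebius_identity:
  "(cmod (1 - cnj w * z))\<^sup>2 = (cmod (z - w))\<^sup>2 + (1 - (cmod z)\<^sup>2) * (1 - (cmod w)\<^sup>2)"
  unfolding cmod_power2 by (simp add: power2_eq_square algebra_simps)

lemma moebius_denom_nonzero:
  assumes "cmod w < 1" "cmod z \<le> 1"
  shows "1 - cnj w * z \<noteq> 0"
proof
  assume "1 - cnj w * z = 0"
  then have "cmod (cnj w * z) = 1" by (metis eq_iff_diff_eq_0 norm_one)
  moreover have "cmod w * cmod z \<le> cmod w * 1" using assms by (intro mult_left_mono) auto
  ultimately show False using assms by (simp add: norm_mult)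
qed

lemma second_primitive_quotient:
  fixes w :: complex
  assumes "cmod w < 1" "P holomorphic_on UNIV"
  obtains f where "d0 f = 0" "d1 f = 0"
    "\<And>z. z \<in> ball 0 1 \<Longrightarrow> d2 f z = P z / (1 - cnj w * z) ^ n"
proof -
  \<comment> \<open>Any radius above 1 that keeps the disc away from the pole
    \<open>1 / cnj w\<close> would do; this one satisfies \<open>cmod w * R < 1\<close> and also
    covers \<open>w = 0\<close>.\<close>
  define R where "R = 2 / (1 + cmod w)"
  have R: "1 < R" "cmod w * R < 1"
    using assms norm_ge_zero[of w] by (auto simp: R_def field_simps add_pos_nonneg)
  have nz: "1 - cnj w * z \<noteq> 0" if "z \<in> ball 0 R" for z
  proof
    assume "1 - cnj w * z = 0"
    then have "cmod (cnj w * z) = 1" by (metis eq_iff_diff_eq_0 norm_one)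
    moreover have "cmod w * cmod z \<le> cmod w * R" using that by (intro mult_left_mono) auto
    ultimately show False using R by (simp add: norm_mult)
  qed
  have "(\<lambda>z. P z / (1 - cnj w * z) ^ n) holomorphic_on ball 0 R"
    using nz by (intro holomorphic_intros holomorphic_on_subset[OF assms(2)]) auto
  then show ?thesis using second_primitive[OF _ R(1)] that by blast
qed

text \<open>Near \<open>w\<close> the function is \<open>(z - w)\<^sup>2\<close> times a bounded
  holomorphic factor; away from \<open>w\<close> the distance is bounded below and the weighted
  bound \<open>M\<close> suffices.\<close>

lemma double_zero_bound:
  assumes h: "h holomorphic_on ball 0 1" and w: "w \<in> ball 0 1"
    and zero: "h w = 0" "deriv h w = 0"
    and M: "\<And>z. z \<in> ball 0 1 \<Longrightarrow> (1 - (cmod z)\<^sup>2) * cmod (h z) \<le> M"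
  obtains C where "0 \<le> C" "\<And>z. z \<in> ball 0 1 \<Longrightarrow> (1 - (cmod z)\<^sup>2) * cmod (h z) \<le> C * (cmod (z - w))\<^sup>2"
proof -
  \<comment> \<open>A difference quotient completed by the derivative at \<open>w\<close> is
    holomorphic; taking it twice divides out the double zero.\<close>
  define k1 where "k1 z = (if z = w then deriv h w else (h z - h w) / (z - w))" for z
  define k where "k z = (if z = w then deriv k1 w else (k1 z - k1 w) / (z - w))" for z
  have wi: "w \<in> interior (ball 0 1)" using w by simp
  have "k1 holomorphic_on ball 0 1"
    unfolding k1_def by (rule pole_lemma[OF h wi])
  then have hk: "k holomorphic_on ball 0 1"
    unfolding k_def by (rule pole_lemma[OF _ wi])
  have hz: "h z = (z - w)\<^sup>2 * k z" for z
    by (cases "z = w") (auto simp: k_def k1_def zero power2_eq_square)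
  obtain e where e: "0 < e" "cball w e \<subseteq> ball 0 1"
    using open_contains_cball[THEN iffD1, OF open_ball] w by blast
  have "compact (k ` cball w e)"
    by (intro compact_continuous_image holomorphic_on_imp_continuous_on holomorphic_on_subset[OF hk e(2)]) auto
  then obtain B where B: "\<And>z. z \<in> cball w e \<Longrightarrow> cmod (k z) \<le> B"
    using compact_imp_bounded[of "k ` cball w e"] unfolding bounded_iff by blast
  have M0: "0 \<le> M" using M[OF w] zero by simp
  have B0: "0 \<le> B" using B[of w] e norm_ge_zero[of "k w"] by (simp del: norm_ge_zero)
  show ?thesis
  \<comment> \<open>\<open>B\<close> serves the points of \<open>cball w e\<close>,
    \<open>M / e\<^sup>2\<close> all others.\<close>
  proof (rule that[of "max B (M / e\<^sup>2)"])
    show "0 \<le> max B (M / e\<^sup>2)" using B0 by simp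
    fix z :: complex assume z: "z \<in> ball 0 1"
    show "(1 - (cmod z)\<^sup>2) * cmod (h z) \<le> max B (M / e\<^sup>2) * (cmod (z - w))\<^sup>2"
    proof (cases "z \<in> cball w e")
      case True
      have "(1 - (cmod z)\<^sup>2) * cmod (h z) \<le> 1 * cmod (h z)"
        by (intro mult_right_mono) auto
      also have "\<dots> = cmod (k z) * (cmod (z - w))\<^sup>2"
        by (simp add: hz norm_mult norm_power)
      also have "\<dots> \<le> max B (M / e\<^sup>2) * (cmod (z - w))\<^sup>2"
        using B[OF True] by (intro mult_right_mono) auto
      finally show ?thesis .
    next
      case False
      then have "e\<^sup>2 \<le> (cmod (z - w))\<^sup>2"
        using e by (intro power_mono) (auto simp: dist_norm norm_minus_commute)
      have "(1 - (cmod z)\<^sup>2) * cmod (h z) \<le> M / e\<^sup>2 * e\<^sup>2" using M[OF z] e by simp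
      also have "\<dots> \<le> M / e\<^sup>2 * (cmod (z - w))\<^sup>2"
        using M0 \<open>e\<^sup>2 \<le> _\<close> by (intro mult_left_mono) auto
      also have "\<dots> \<le> max B (M / e\<^sup>2) * (cmod (z - w))\<^sup>2"
        by (intro mult_right_mono) auto
      finally show ?thesis .
    qed
  qed
qed

text \<open>Up to a sign, \<open>g''\<close> is the derivative of a disc automorphism, and its weighted modulus
  equals 1 minus the squared pseudo-hyperbolic distance to \<open>w\<close>, which leaves room for a
  perturbation with a double zero at \<open>w\<close>.\<close>

lemma hermitian_perturbed_peak:
  fixes S :: "zygmund0 \<Rightarrow> zygmund0"
  assumes S: "bounded_hermitian S" and w: "w \<in> ball 0 1"
    and g: "d0 g = 0" "d1 g = 0"
      "\<And>z. z \<in> ball 0 1 \<Longrightarrow> d2 g z = of_real (1 - (cmod w)\<^sup>2) / (1 - cnj w * z)\<^sup>2"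
    and f: "d0 f = 0" "d1 f = 0" "d2 f w = 0"
    and C: "\<And>z. z \<in> ball 0 1 \<Longrightarrow> (1 - (cmod z)\<^sup>2) * cmod (d2 f z) \<le> (cmod (z - w))\<^sup>2 / 4"
  shows "Im (d2 (S (g + f)) w) = 0"
proof -
  have vw: "0 < 1 - (cmod w)\<^sup>2" by (rule disc_weight_pos[OF w])
  have peak: "of_real (1 - (cmod w)\<^sup>2) * d2 (g + f) w = 1"
  proof -
    have "1 - cnj w * w = of_real (1 - (cmod w)\<^sup>2)"
      by (simp only: complex_norm_square of_real_diff of_real_1 mult.commute)
    then have "d2 (g + f) w = of_real (1 - (cmod w)\<^sup>2) / (of_real (1 - (cmod w)\<^sup>2))\<^sup>2"
      by (simp only: jet_add(3)[OF w] g(3)[OF w] f(3) add_0_right)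
    moreover have "complex_of_real (1 - (cmod w)\<^sup>2) \<noteq> 0"
      using vw by (simp only: of_real_eq_0_iff)
    ultimately show ?thesis by (simp add: power2_eq_square del: of_real_diff)
  qed
  have "norm (g + f) \<le> cmod (d0 (g + f)) + cmod (d1 (g + f)) + 1"
  proof (rule zygmund0_norm_le)
    fix z :: complex assume z: "z \<in> ball 0 1"
    define N where "N = (cmod (1 - cnj w * z))\<^sup>2"
    have Nid: "N = (cmod (z - w))\<^sup>2 + (1 - (cmod z)\<^sup>2) * (1 - (cmod w)\<^sup>2)"
      unfolding N_def by (rule moebius_identity)
    have N0: "0 < N"
      using moebius_denom_nonzero[of w z] w z by (simp add: N_def)
    \<comment> \<open>The bound \<open>N \<le> 4\<close> explains the factor 1/4 in the hypothesis
      on \<open>f\<close>: it turns that bound into \<open>(cmod (z - w))\<^sup>2 / N\<close>,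
      exactly the room left by the peak.\<close>
    have "cmod (1 - cnj w * z) \<le> cmod 1 + cmod (cnj w * z)" by (rule norm_triangle_ineq4)
    also have "\<dots> \<le> 2" using w z mult_mono[of "cmod w" 1 "cmod z" 1] by (simp add: norm_mult)
    finally have "N \<le> 2\<^sup>2" unfolding N_def by (intro power_mono) auto
    then have N4: "N \<le> 4" by simp
    have "(1 - (cmod z)\<^sup>2) * cmod (d2 (g + f) z)
        \<le> (1 - (cmod z)\<^sup>2) * (cmod (d2 g z) + cmod (d2 f z))"
      unfolding jet_add(3)[OF z]
      using disc_weight_pos[OF z] by (intro mult_left_mono norm_triangle_ineq) simp
    also have "\<dots> = (1 - (cmod z)\<^sup>2) * (1 - (cmod w)\<^sup>2) / N + (1 - (cmod z)\<^sup>2) * cmod (d2 f z)"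
    proof -
      have "cmod (d2 g z) = (1 - (cmod w)\<^sup>2) / N"
        unfolding g(3)[OF z] norm_divide norm_power norm_of_real N_def using vw by simp
      then show ?thesis by (simp add: distrib_left)
    qed
    also have "\<dots> \<le> (1 - (cmod z)\<^sup>2) * (1 - (cmod w)\<^sup>2) / N + (cmod (z - w))\<^sup>2 / N"
    proof -
      have "(cmod (z - w))\<^sup>2 / 4 \<le> (cmod (z - w))\<^sup>2 / N"
        using N0 N4 by (intro divide_left_mono) auto
      then show ?thesis using C[OF z] by linarith
    qed
    also have "\<dots> = 1" using N0 by (simp add: Nid add_divide_distrib[symmetric] add.commute)
    finally show "(1 - (cmod z)\<^sup>2) * cmod (d2 (g + f) z) \<le> 1" .
  qed
  then have "norm (g + f) \<le> 1" by (simp add: jet_add g f)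
  moreover have "1 \<le> norm (g + f)"
    using jet_functional_le_norm[of 0 0 1 w "g + f"] w peak by simp
  ultimately have n: "norm (g + f) = 1" by simp
  \<comment> \<open>With the initial-value components switched off, the support functional at
    \<open>g + f\<close> is weighted evaluation of the second derivative at
    \<open>w\<close>.\<close>
  have "Im (0 * d0 (S (g + f)) + 0 * d1 (S (g + f)) + 1 * of_real (1 - (cmod w)\<^sup>2) * d2 (S (g + f)) w) = 0"
    by (rule hermitian_support_zygmund0[OF S]) (use w peak n in auto)
  then have "(1 - (cmod w)\<^sup>2) * Im (d2 (S (g + f)) w) = 0"
    by (simp only: mult_zero_left add_0 mult_1 Im_complex_of_real Re_complex_of_real times_complex.sel)
  then show ?thesis using vw by simp
qed

section \<open>Structure of hermitian operators\<close>

text \<open>The decoupling device: \<open>a\<close> collects the components whose coefficients are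
  fixed by attainment of the norm, \<open>b\<close> one whose coefficient is free because the
  function vanishes there. Testing 0, 1 and \<open>\<i>\<close> separates them.\<close>

lemma unit_coefficients_real:
  assumes "\<And>\<nu>. cmod \<nu> \<le> 1 \<Longrightarrow> Im (a + \<nu> * b) = 0"
  shows "Im a = 0" "b = 0"
proof -
  show a: "Im a = 0" using assms[of 0] by simp
  have "Im b = 0" "Re b = 0" using assms[of 1] assms[of \<i>] a by auto
  then show "b = 0" by (simp add: complex_eq_iff)
qed

lemma hermitian_zygmund0_form:
  fixes S :: "zygmund0 \<Rightarrow> zygmund0"
  assumes S: "bounded_hermitian S"
  obtains \<beta>\<^sub>0 \<beta>\<^sub>1 \<alpha> :: real where
    "\<And>f. d0 (S f) = of_real \<beta>\<^sub>0 * d0 f" "\<And>f. d1 (S f) = of_real \<beta>\<^sub>1 * d1 f"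
    "\<And>f z. z \<in> ball 0 1 \<Longrightarrow> d2 (S f) z = of_real \<alpha> * d2 f z"
proof -
  have bl: "bounded_linear S" and SC: "\<And>c x. S (c *\<^sub>C x) = c *\<^sub>C S x"
    using S by (auto simp: bounded_hermitian_def bounded_clinear_def)
  have SA: "S (x + y) = S x + S y" for x y
    using bl by (simp add: bounded_linear.axioms(1) linear_add)
  obtain B where B: "0 < B" "\<And>x. norm (S x) \<le> norm x * B"
    using bounded_linear.pos_bounded[OF bl] by blast
  obtain e0 where e0: "d0 e0 = 1" "d1 e0 = 0" "\<And>z. z \<in> ball 0 1 \<Longrightarrow> d2 e0 z = 0"
    by (rule constant_zygmund0) (rule that)
  obtain e1 where e1: "d0 e1 = 0" "d1 e1 = 1" "\<And>z. z \<in> ball 0 1 \<Longrightarrow> d2 e1 z = 0"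
    by (rule identity_zygmund0) (rule that)
  have n0: "norm e0 = 1"
    using zygmund0_norm_le[of e0 0] jet_functional_le_norm[of 1 0 0 0 e0] by (simp add: e0)
  have n1: "norm e1 = 1"
    using zygmund0_norm_le[of e1 0] jet_functional_le_norm[of 0 1 0 0 e1] by (simp add: e1)
  have vpos: "complex_of_real (1 - (cmod w)\<^sup>2) \<noteq> 0" if "w \<in> ball 0 1" for w :: complex
    using disc_weight_pos[OF that] by (simp only: of_real_eq_0_iff)

  \<comment> \<open>The whole norm of \<open>e0\<close> sits in \<open>d0\<close>, so the
    coefficients of the other components are free and \<open>S e0\<close> must vanish there. The
    same argument with \<open>d1\<close> serves \<open>e1\<close>.\<close>
  have Im0: "Im (d0 (S e0)) = 0" and d1e0: "d1 (S e0) = 0"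
  proof -
    have "Im (d0 (S e0) + \<nu> * d1 (S e0)) = 0" if "cmod \<nu> \<le> 1" for \<nu>
      using hermitian_support_zygmund0[OF S, of 1 \<nu> 0 0 e0] that by (simp add: e0 n0)
    from unit_coefficients_real[OF this] show "Im (d0 (S e0)) = 0" "d1 (S e0) = 0" by auto
  qed
  have d2e0: "d2 (S e0) w = 0" if w: "w \<in> ball 0 1" for w
  proof -
    have "Im (d0 (S e0) + \<kappa> * (of_real (1 - (cmod w)\<^sup>2) * d2 (S e0) w)) = 0" if "cmod \<kappa> \<le> 1" for \<kappa>
      using hermitian_support_zygmund0[OF S, of 1 0 \<kappa> w e0] that w
      by (simp add: e0 n0 mult.assoc)
    from unit_coefficients_real(2)[OF this] vpos[OF w] show ?thesis by simp
  qed
  have Im1: "Im (d1 (S e1)) = 0" and d0e1: "d0 (S e1) = 0"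
  proof -
    have "Im (d1 (S e1) + \<mu> * d0 (S e1)) = 0" if "cmod \<mu> \<le> 1" for \<mu>
      using hermitian_support_zygmund0[OF S, of \<mu> 1 0 0 e1] that by (simp add: e1 n1 add.commute)
    from unit_coefficients_real[OF this] show "Im (d1 (S e1)) = 0" "d0 (S e1) = 0" by auto
  qed
  have d2e1: "d2 (S e1) w = 0" if w: "w \<in> ball 0 1" for w
  proof -
    have "Im (d1 (S e1) + \<kappa> * (of_real (1 - (cmod w)\<^sup>2) * d2 (S e1) w)) = 0" if "cmod \<kappa> \<le> 1" for \<kappa>
      using hermitian_support_zygmund0[OF S, of 0 1 \<kappa> w e1] that w
      by (simp add: e1 n1 mult.assoc)
    from unit_coefficients_real(2)[OF this] vpos[OF w] show ?thesis by simp
  qed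

  \<comment> \<open>The norm of \<open>f\<close> is attained by the second-derivative component,
    which leaves the coefficients of \<open>d0\<close> and \<open>d1\<close> free.\<close>
  have initial_zero: "d0 (S f) = 0" "d1 (S f) = 0" if f: "d0 f = 0" "d1 f = 0" for f
  proof -
    obtain w where w: "w \<in> ball 0 1" "norm f = (1 - (cmod w)\<^sup>2) * cmod (d2 f w)"
      using zygmund0_norm_attained[OF f] by blast
    \<comment> \<open>Rotates \<open>d2 f w\<close> to its modulus. If \<open>d2 f w = 0\<close>,
      then \<open>sgn\<close> returns 0, so only \<open>cmod \<kappa> \<le> 1\<close> is
      claimed.\<close>
    define \<kappa> where "\<kappa> = cnj (sgn (d2 f w))"
    have \<kappa>: "cmod \<kappa> \<le> 1" by (simp add: \<kappa>_def norm_sgn)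
    have \<kappa>w: "\<kappa> * d2 f w = of_real (cmod (d2 f w))"
      by (cases "d2 f w = 0")
        (auto simp: \<kappa>_def sgn_eq complex_norm_square[symmetric] power2_eq_square mult.commute[of "cnj _"])
    have att: "\<kappa> * of_real (1 - (cmod w)\<^sup>2) * d2 f w = norm f"
      unfolding w(2) of_real_mult \<kappa>w[symmetric] by (simp only: mult_ac)
    define a where "a = \<kappa> * of_real (1 - (cmod w)\<^sup>2) * d2 (S f) w"
    have "Im (a + \<mu> * d0 (S f)) = 0" "Im (a + \<mu> * d1 (S f)) = 0" if \<mu>: "cmod \<mu> \<le> 1" for \<mu>
    proof -
      have "Im (\<mu> * d0 (S f) + 0 * d1 (S f) + a) = 0"
        unfolding a_def by (rule hermitian_support_zygmund0[OF S \<mu> _ \<kappa> w(1)]) (simp_all only: f att, simp_all)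
      then show "Im (a + \<mu> * d0 (S f)) = 0" by (simp add: add.commute)
      have "Im (0 * d0 (S f) + \<mu> * d1 (S f) + a) = 0"
        unfolding a_def by (rule hermitian_support_zygmund0[OF S _ \<mu> \<kappa> w(1)]) (simp_all only: f att, simp_all)
      then show "Im (a + \<mu> * d1 (S f)) = 0" by (simp add: add.commute)
    qed
    then show "d0 (S f) = 0" "d1 (S f) = 0"
      using unit_coefficients_real(2) by blast+
  qed

  have peak_real: "Im (d2 (S g) w) = 0"
    if w: "w \<in> ball 0 1" and g: "d0 g = 0" "d1 g = 0"
      "\<And>z. z \<in> ball 0 1 \<Longrightarrow> d2 g z = of_real (1 - (cmod w)\<^sup>2) / (1 - cnj w * z)\<^sup>2" for g w
  proof -
    \<comment> \<open>The unperturbed peak is the case of the perturbation 0, written as a multiple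
      of \<open>g\<close> so that the component rules apply.\<close>
    have z0: "d2 (0 *\<^sub>C g) z = 0" if "z \<in> ball 0 1" for z using that by (simp add: jet_scaleC)
    have "Im (d2 (S (g + 0 *\<^sub>C g)) w) = 0"
      by (rule hermitian_perturbed_peak[OF S w g]) (use z0 w in \<open>auto simp: jet_scaleC\<close>)
    then show ?thesis using w by (simp add: SA SC jet_add jet_scaleC)
  qed

  \<comment> \<open>A scaled \<open>f\<close> is an admissible perturbation of the peak at
    \<open>w\<close> under every rotation \<open>\<mu>\<close>, so the decoupling device annihilates
    its image at \<open>w\<close>.\<close>
  have double_zero: "d2 (S f) w = 0"
    if w: "w \<in> ball 0 1" and f: "d0 f = 0" "d1 f = 0" "d2 f w = 0" "deriv (d2 f) w = 0" for f w
  proof -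
    obtain g where g: "d0 g = 0" "d1 g = 0"
      "\<And>z. z \<in> ball 0 1 \<Longrightarrow> d2 g z = of_real (1 - (cmod w)\<^sup>2) / (1 - cnj w * z)\<^sup>2"
      by (rule second_primitive_quotient[of w "\<lambda>_. of_real (1 - (cmod w)\<^sup>2)" 2]) (use w in \<open>auto intro: that\<close>)
    obtain C where C: "0 \<le> C"
      "\<And>z. z \<in> ball 0 1 \<Longrightarrow> (1 - (cmod z)\<^sup>2) * cmod (d2 f z) \<le> C * (cmod (z - w))\<^sup>2"
      using double_zero_bound[OF d2_holomorphic w f(3,4) zygmund0_weight_le_norm] by blast
    define \<epsilon> where "\<epsilon> = 1 / (4 * (C + 1))"
    have \<epsilon>: "0 < \<epsilon>" "\<epsilon> * C \<le> 1 / 4" using C(1) by (auto simp: \<epsilon>_def field_simps)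
    have "Im (d2 (S g) w + \<mu> * (of_real \<epsilon> * d2 (S f) w)) = 0" if \<mu>: "cmod \<mu> \<le> 1" for \<mu>
    proof -
      have "Im (d2 (S (g + (\<mu> * of_real \<epsilon>) *\<^sub>C f)) w) = 0"
      proof (rule hermitian_perturbed_peak[OF S w g])
        fix z :: complex assume z: "z \<in> ball 0 1"
        have "(1 - (cmod z)\<^sup>2) * cmod (d2 ((\<mu> * of_real \<epsilon>) *\<^sub>C f) z)
            = (cmod \<mu> * \<epsilon>) * ((1 - (cmod z)\<^sup>2) * cmod (d2 f z))"
          using \<epsilon> z by (simp add: jet_scaleC norm_mult mult_ac)
        also have "\<dots> \<le> (1 * \<epsilon>) * (C * (cmod (z - w))\<^sup>2)"
          using \<mu> \<epsilon> disc_weight_pos[OF z]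
          by (intro mult_mono[OF mult_right_mono C(2)[OF z]] mult_nonneg_nonneg) simp_all
        also have "\<dots> = (\<epsilon> * C) * (cmod (z - w))\<^sup>2" by simp
        also have "\<dots> \<le> 1 / 4 * (cmod (z - w))\<^sup>2" using \<epsilon>(2) by (intro mult_right_mono) auto
        finally show "(1 - (cmod z)\<^sup>2) * cmod (d2 ((\<mu> * of_real \<epsilon>) *\<^sub>C f) z) \<le> (cmod (z - w))\<^sup>2 / 4"
          by simp
      qed (use w f in \<open>auto simp: jet_scaleC\<close>)
      then show ?thesis using w by (simp add: SA SC jet_add jet_scaleC mult.assoc)
    qed
    from unit_coefficients_real(2)[OF this] \<epsilon>(1) show ?thesis by simp
  qed

  \<comment> \<open>\<open>p2\<close> and \<open>p3\<close> have second derivatives 1 and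
    \<open>z\<close>; their combinations realise every first-order Taylor polynomial of a second
    derivative.\<close>
  obtain p2 where p2: "d0 p2 = 0" "d1 p2 = 0" "\<And>z. z \<in> ball 0 1 \<Longrightarrow> d2 p2 z = 1"
    by (rule second_primitive[of "\<lambda>_. 1" 2]) (auto intro: that)
  obtain p3 where p3: "d0 p3 = 0" "d1 p3 = 0" "\<And>z. z \<in> ball 0 1 \<Longrightarrow> d2 p3 z = z"
    by (rule second_primitive[of "\<lambda>z. z" 2]) (auto intro: that)
  define a where "a = d2 (S p2)"
  \<comment> \<open>By linearity this is the second derivative at \<open>w\<close> of the image of
    \<open>p3 - w p2\<close>, whose own second derivative is \<open>z - w\<close>.\<close>
  define G where "G w = d2 (S p3) w - w * a w" for w
  have first_order: "d2 (S f) w = a w * d2 f w + G w * deriv (d2 f) w"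
    if w: "w \<in> ball 0 1" and f: "d0 f = 0" "d1 f = 0" for f w
  proof -
    define b where "b = deriv (d2 f) w"
    \<comment> \<open>\<open>c + b * z\<close> is the first-order Taylor polynomial of
      \<open>d2 f\<close> at \<open>w\<close>; subtracting it leaves a double zero.\<close>
    define c where "c = d2 f w - w * b"
    define h where "h = f + ((- c) *\<^sub>C p2 + (- b) *\<^sub>C p3)"
    have h2: "d2 h z = d2 f z - c - b * z" if "z \<in> ball 0 1" for z
      using that by (simp add: h_def jet_add jet_scaleC p2 p3)
    have "((\<lambda>z. d2 f z - c - b * z) has_field_derivative b - 0 - b * 1) (at w)"
      unfolding b_def
      by (auto intro!: derivative_eq_intros holomorphic_derivI[OF d2_holomorphic open_ball w])
    then have "deriv (\<lambda>z. d2 f z - c - b * z) w = 0"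
      using DERIV_imp_deriv by fastforce
    moreover have "deriv (d2 h) w = deriv (\<lambda>z. d2 f z - c - b * z) w"
      by (rule complex_derivative_transform_within_open[OF d2_holomorphic _ open_ball w h2])
        (intro holomorphic_intros d2_holomorphic)
    ultimately have "deriv (d2 h) w = 0" by simp
    then have "d2 (S h) w = 0"
      using double_zero[OF w, of h] h2[OF w] by (simp add: h_def jet_add jet_scaleC f p2 p3 c_def)
    then have "d2 (S f) w + ((- c) * a w + (- b) * d2 (S p3) w) = 0"
      using w by (simp add: h_def SA SC jet_add jet_scaleC a_def)
    then show ?thesis
      unfolding c_def G_def b_def[symmetric] by algebra
  qed

  have G_bound: "cmod (G w) \<le> B * (1 - (cmod w)\<^sup>2)" if w: "w \<in> ball 0 1" for w
  proof -
    define v where "v = 1 - (cmod w)\<^sup>2"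
    have v: "0 < v" unfolding v_def by (rule disc_weight_pos[OF w])
    have vw: "1 - cnj w * w = of_real v"
      by (simp only: v_def complex_norm_square of_real_diff of_real_1 mult.commute)
    \<comment> \<open>At \<open>w\<close> the function \<open>d2 h\<close> vanishes with derivative
      \<open>1 / v^3\<close>, so \<open>S h\<close> sees only \<open>G w / v^3\<close> there, while
      \<open>norm h \<le> 1 / v\<close>. Boundedness and the weight \<open>v\<close> at
      \<open>w\<close> then give \<open>cmod (G w) \<le> B * v\<close>.\<close>
    obtain h where h: "d0 h = 0" "d1 h = 0"
      "\<And>z. z \<in> ball 0 1 \<Longrightarrow> d2 h z = (z - w) / (1 - cnj w * z) ^ 3"
      by (rule second_primitive_quotient[of w "\<lambda>z. z - w" 3])
        (use w in \<open>auto intro: that holomorphic_intros\<close>)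
    have nz: "1 - cnj w * z \<noteq> 0" if "z \<in> ball 0 1" for z
      using moebius_denom_nonzero[of w z] w that by simp
    have "norm h \<le> cmod (d0 h) + cmod (d1 h) + 1 / v"
    proof (rule zygmund0_norm_le)
      fix z :: complex assume z: "z \<in> ball 0 1"
      define N where "N = cmod (1 - cnj w * z)"
      have N: "0 < N" using nz[OF z] by (simp add: N_def)
      have Nid: "N\<^sup>2 = (cmod (z - w))\<^sup>2 + (1 - (cmod z)\<^sup>2) * v"
        unfolding N_def v_def by (rule moebius_identity)
      \<comment> \<open>Both summands of \<open>Nid\<close> are nonnegative, so
        \<open>N\<^sup>2\<close> dominates each of them separately.\<close>
      have "0 \<le> (1 - (cmod z)\<^sup>2) * v" using disc_weight_pos[OF z] v by simp
      then have "(cmod (z - w))\<^sup>2 \<le> N\<^sup>2" using Nid by linarith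
      then have zw: "cmod (z - w) \<le> N"
        by (rule power2_le_imp_le) (use N in simp)
      have vz: "(1 - (cmod z)\<^sup>2) \<le> N\<^sup>2 / v"
        using Nid v by (simp add: pos_le_divide_eq)
      have "(1 - (cmod z)\<^sup>2) * cmod (d2 h z) = (1 - (cmod z)\<^sup>2) * (cmod (z - w) / N ^ 3)"
        by (simp add: h(3)[OF z] norm_divide norm_power N_def)
      also have "\<dots> \<le> N\<^sup>2 / v * (N / N ^ 3)"
        using vz zw N v by (intro mult_mono divide_right_mono) auto
      also have "\<dots> = 1 / v" using N by (simp add: power2_eq_square power3_eq_cube)
      finally show "(1 - (cmod z)\<^sup>2) * cmod (d2 h z) \<le> 1 / v" .
    qed
    then have nh: "norm h \<le> 1 / v" by (simp add: h)
    have "((\<lambda>z. (z - w) / (1 - cnj w * z) ^ 3) has_field_derivative 1 / of_real v ^ 3) (at w)"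
      using v nz[OF w] by (auto intro!: derivative_eq_intros simp: vw power2_eq_square power3_eq_cube)
    moreover have "deriv (d2 h) w = deriv (\<lambda>z. (z - w) / (1 - cnj w * z) ^ 3) w"
      by (rule complex_derivative_transform_within_open[OF d2_holomorphic _ open_ball w h(3)])
        (use nz in \<open>auto intro!: holomorphic_intros\<close>)
    ultimately have dh: "deriv (d2 h) w = 1 / of_real v ^ 3"
      using DERIV_imp_deriv by metis
    have "v * cmod (d2 (S h) w) \<le> norm (S h)"
      unfolding v_def by (rule zygmund0_weight_le_norm[OF w])
    also have "\<dots> \<le> norm h * B" by (rule B)
    also have "\<dots> \<le> 1 / v * B" using nh B(1) by (intro mult_right_mono) auto
    finally have "v * cmod (d2 (S h) w) \<le> B / v" by simp
    moreover have "cmod (d2 (S h) w) = cmod (G w) / v ^ 3"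
      using first_order[OF w h(1,2)] v by (simp add: h(3)[OF w] dh norm_mult norm_divide norm_power)
    ultimately show ?thesis
      using v unfolding v_def[symmetric] by (simp add: power3_eq_cube field_simps)
  qed

  have hG: "G holomorphic_on ball 0 1"
    unfolding G_def a_def by (intro holomorphic_intros d2_holomorphic)
  have G0: "G w = 0" if w: "w \<in> ball 0 1" for w
  proof -
    \<comment> \<open>The estimate is constant on each circle of radius \<open>r < 1\<close>, the
      maximum principle carries it to the fixed \<open>w\<close>, and it tends to 0 as
      \<open>r\<close> tends to 1.\<close>
    have "cmod (G w) \<le> B * (1 - r\<^sup>2)" if r: "cmod w < r" "r < 1" for r
    proof (rule maximum_modulus_frontier[of G "ball 0 r"])
      have r0: "0 < r" using r(1) norm_ge_zero[of w] by linarith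
      show "G holomorphic_on interior (ball 0 r)"
        by (rule holomorphic_on_subset[OF hG]) (use r in auto)
      show "continuous_on (closure (ball 0 r)) G"
        by (rule continuous_on_subset[OF holomorphic_on_imp_continuous_on[OF hG]]) (use r r0 in auto)
      show "cmod (G z) \<le> B * (1 - r\<^sup>2)" if "z \<in> frontier (ball 0 r)" for z
        using G_bound[of z] that r r0 by (auto simp: frontier_ball)
      show "w \<in> ball 0 r" using r by simp
    qed simp
    then have "\<forall>\<^sub>F r in at_left 1. cmod (G w) \<le> B * (1 - r\<^sup>2)"
      using w eventually_at_left[of "cmod w" "1::real"] by auto
    moreover have "((\<lambda>r::real. B * (1 - r\<^sup>2)) \<longlongrightarrow> B * (1 - 1\<^sup>2)) (at_left 1)"
      by (intro tendsto_intros)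
    ultimately have "cmod (G w) \<le> B * (1 - 1\<^sup>2)"
      using tendsto_lowerbound trivial_limit_at_left_real by blast
    then show ?thesis by simp
  qed

  \<comment> \<open>With \<open>G = 0\<close>, the peak function at \<open>w\<close> is sent to
    \<open>a w\<close> times a positive number, as far as the second derivative at \<open>w\<close>
    is concerned, and that value is real.\<close>
  have a_real: "Im (a w) = 0" if w: "w \<in> ball 0 1" for w
  proof -
    obtain g where g: "d0 g = 0" "d1 g = 0"
      "\<And>z. z \<in> ball 0 1 \<Longrightarrow> d2 g z = of_real (1 - (cmod w)\<^sup>2) / (1 - cnj w * z)\<^sup>2"
      by (rule second_primitive_quotient[of w "\<lambda>_. of_real (1 - (cmod w)\<^sup>2)" 2]) (use w in \<open>auto intro: that\<close>)
    have "1 - cnj w * w = of_real (1 - (cmod w)\<^sup>2)"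
      by (simp only: complex_norm_square of_real_diff of_real_1 mult.commute)
    then have "d2 g w = of_real (1 / (1 - (cmod w)\<^sup>2))"
      unfolding g(3)[OF w] using vpos[OF w] by (simp add: power2_eq_square del: of_real_diff)
    then have "Im (a w) * (1 / (1 - (cmod w)\<^sup>2)) = 0"
      using peak_real[OF w g] first_order[OF w g(1,2)] G0[OF w]
      by (simp del: of_real_divide of_real_diff)
    then show ?thesis using disc_weight_pos[OF w] by simp
  qed
  obtain c where c: "\<And>w. w \<in> ball 0 1 \<Longrightarrow> a w = c"
  proof -
    have "a constant_on ball 0 1"
    proof (rule ccontr)
      \<comment> \<open>Otherwise the open image would contain a point vertically above the real
        number \<open>a 0\<close>.\<close>
      assume "\<not> a constant_on ball 0 1"
      then have "open (a ` ball 0 1)"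
        using d2_holomorphic by (intro open_mapping_thm[of a "ball 0 1"]) (auto simp: a_def)
      moreover have "a 0 \<in> a ` ball 0 1" by simp
      ultimately obtain e where e: "0 < e" "cball (a 0) e \<subseteq> a ` ball 0 1"
        using open_contains_cball by blast
      have "a 0 + of_real e * \<i> \<in> cball (a 0) e"
        using e(1) by (simp add: dist_norm norm_mult)
      then obtain z where "z \<in> ball 0 1" "a z = a 0 + of_real e * \<i>"
        using e(2) by force
      then show False using a_real[of z] a_real[of 0] e(1) by simp
    qed
    then show ?thesis using that unfolding constant_on_def by blast
  qed
  have ca: "c = of_real (Re c)"
    using a_real[of 0] c[of 0] by (simp add: complex_eq_iff)
  have S2: "d2 (S f) w = c * d2 f w" if "w \<in> ball 0 1" "d0 f = 0" "d1 f = 0" for f w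
    using first_order[OF that] G0[OF that(1)] c[OF that(1)] by simp
  show ?thesis
  proof (rule that[of "Re (d0 (S e0))" "Re (d1 (S e1))" "Re c"])
    fix f
    \<comment> \<open>Stripping off initial values keeps the second derivative, and \<open>S\<close>
      is already known on each of the three resulting pieces.\<close>
    define f0 where "f0 = f + ((- d0 f) *\<^sub>C e0 + (- d1 f) *\<^sub>C e1)"
    have f0: "d0 f0 = 0" "d1 f0 = 0" "\<And>z. z \<in> ball 0 1 \<Longrightarrow> d2 f0 z = d2 f z"
      by (simp_all add: f0_def jet_add jet_scaleC e0 e1)
    have f: "f = f0 + (d0 f *\<^sub>C e0 + d1 f *\<^sub>C e1)"
      by (rule zygmund0_eqI) (simp_all add: f0 jet_add jet_scaleC e0 e1)
    have Sf: "S f = S f0 + (d0 f *\<^sub>C S e0 + d1 f *\<^sub>C S e1)"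
      by (subst f) (simp add: SA SC)
    have r: "d0 (S e0) = of_real (Re (d0 (S e0)))" "d1 (S e1) = of_real (Re (d1 (S e1)))"
      using Im0 Im1 by (simp_all add: complex_eq_iff)
    show "d0 (S f) = of_real (Re (d0 (S e0))) * d0 f"
      unfolding r(1)[symmetric] Sf by (simp add: jet_add jet_scaleC initial_zero[OF f0(1,2)] d0e1)
    show "d1 (S f) = of_real (Re (d1 (S e1))) * d1 f"
      unfolding r(2)[symmetric] Sf by (simp add: jet_add jet_scaleC initial_zero[OF f0(1,2)] d1e0)
    show "d2 (S f) z = of_real (Re c) * d2 f z" if "z \<in> ball 0 1" for z
      unfolding ca[symmetric] Sf
      using that by (simp add: jet_add jet_scaleC S2[OF that f0(1,2)] f0 d2e0 d2e1)
  qed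
qed

section \<open>Component-diagonal operators and the explicit formula\<close>

text \<open>The pointwise formula describes an element of the space, and elements are determined by
  their components. The term with \<open>c\<close> contributes to all three, hence the sums
  \<open>a + c\<close> and \<open>b + c\<close>.\<close>

lemma affine_combination_iff:
  "(\<forall>z\<in>ball 0 1. Rep_zygmund0 g z = a * d0 f + b * d1 f * z + c * Rep_zygmund0 f z) \<longleftrightarrow>
    d0 g = (a + c) * d0 f \<and> d1 g = (b + c) * d1 f \<and> (\<forall>z\<in>ball 0 1. d2 g z = c * d2 f z)"
    (is "?L \<longleftrightarrow> ?R")
proof -
  obtain e0 where e0: "\<And>z. z \<in> ball 0 1 \<Longrightarrow> Rep_zygmund0 e0 z = 1"
    "d0 e0 = 1" "d1 e0 = 0" "\<And>z. z \<in> ball 0 1 \<Longrightarrow> d2 e0 z = 0"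
    by (rule constant_zygmund0) (rule that)
  obtain e1 where e1: "\<And>z. z \<in> ball 0 1 \<Longrightarrow> Rep_zygmund0 e1 z = z"
    "d0 e1 = 0" "d1 e1 = 1" "\<And>z. z \<in> ball 0 1 \<Longrightarrow> d2 e1 z = 0"
    by (rule identity_zygmund0) (rule that)
  define h where "h = (a * d0 f) *\<^sub>C e0 + (b * d1 f) *\<^sub>C e1 + c *\<^sub>C f"
  have h: "d0 h = (a + c) * d0 f" "d1 h = (b + c) * d1 f" "\<And>z. z \<in> ball 0 1 \<Longrightarrow> d2 h z = c * d2 f z"
    by (simp_all add: h_def jet_add jet_scaleC e0 e1 distrib_right)
  have Rh: "Rep_zygmund0 h z = a * d0 f + b * d1 f * z + c * Rep_zygmund0 f z" if "z \<in> ball 0 1" for z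
    by (simp only: h_def Rep_zygmund0_add Rep_zygmund0_scaleC e0(1)[OF that] e1(1)[OF that] mult_1_right)
  have "?L \<longleftrightarrow> g = h"
  proof
    assume L: ?L
    have "Rep_zygmund0 g z = Rep_zygmund0 h z" for z
      using L Rh[of z] zygmundD(1)[OF Rep_zygmund0_zygmund, of z] by (cases "z \<in> ball 0 1") auto
    then show "g = h" by (metis Rep_zygmund0_inject ext)
  qed (use Rh in auto)
  also have "\<dots> \<longleftrightarrow> ?R"
    using zygmund0_eqI[of g h] h by auto
  finally show ?thesis .
qed

lemma bounded_linear_scaleC_left: "bounded_linear (\<lambda>c. c *\<^sub>C (x :: 'a::complex_normed_vector))"
  by (rule bounded_linear_intro[where K = "norm x"])
    (simp_all add: scaleC_add_left scaleR_scaleC scaleC_scaleC norm_scaleC scaleR_conv_of_real)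

text \<open>Each \<open>(T ^^ n) f\<close> combines the fixed elements \<open>x0\<close>,
  \<open>x1\<close>, \<open>x2\<close> with coefficients \<open>p ^ n\<close>, \<open>q ^ n\<close>,
  \<open>r ^ n\<close>, so the operator series reduces to three scalar exponential series.\<close>

lemma exp_op_diagonal:
  assumes T: "\<And>f. d0 (T f) = p * d0 f" "\<And>f. d1 (T f) = q * d1 f"
    "\<And>f z. z \<in> ball 0 1 \<Longrightarrow> d2 (T f) z = r * d2 f z"
  shows "d0 (exp_op T f) = exp p * d0 f" "d1 (exp_op T f) = exp q * d1 f"
    "z \<in> ball 0 1 \<Longrightarrow> d2 (exp_op T f) z = exp r * d2 f z"
proof -
  obtain e0 where e0: "\<And>z. z \<in> ball 0 1 \<Longrightarrow> Rep_zygmund0 e0 z = 1"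
    "d0 e0 = 1" "d1 e0 = 0" "\<And>z. z \<in> ball 0 1 \<Longrightarrow> d2 e0 z = 0"
    by (rule constant_zygmund0) (rule that)
  obtain e1 where e1: "\<And>z. z \<in> ball 0 1 \<Longrightarrow> Rep_zygmund0 e1 z = z"
    "d0 e1 = 0" "d1 e1 = 1" "\<And>z. z \<in> ball 0 1 \<Longrightarrow> d2 e1 z = 0"
    by (rule identity_zygmund0) (rule that)
  define x0 where "x0 = d0 f *\<^sub>C e0"
  define x1 where "x1 = d1 f *\<^sub>C e1"
  define x2 where "x2 = f + ((- d0 f) *\<^sub>C e0 + (- d1 f) *\<^sub>C e1)"
  note x_simps = x0_def x1_def x2_def jet_add jet_scaleC e0 e1
  have Tn: "d0 ((T ^^ n) f) = p ^ n * d0 f" "d1 ((T ^^ n) f) = q ^ n * d1 f"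
    "z \<in> ball 0 1 \<Longrightarrow> d2 ((T ^^ n) f) z = r ^ n * d2 f z" for n z
    by (induction n) (simp_all add: T)
  have "(T ^^ n) f /\<^sub>R fact n
      = (p ^ n /\<^sub>R fact n) *\<^sub>C x0 + (q ^ n /\<^sub>R fact n) *\<^sub>C x1 + (r ^ n /\<^sub>R fact n) *\<^sub>C x2" for n
    by (rule zygmund0_eqI) (simp_all add: scaleR_scaleC x_simps Tn scaleR_conv_of_real)
  moreover have "(\<lambda>n. (p ^ n /\<^sub>R fact n) *\<^sub>C x0 + (q ^ n /\<^sub>R fact n) *\<^sub>C x1 + (r ^ n /\<^sub>R fact n) *\<^sub>C x2)
      sums (exp p *\<^sub>C x0 + exp q *\<^sub>C x1 + exp r *\<^sub>C x2)"
    by (intro sums_add bounded_linear.sums[OF bounded_linear_scaleC_left] exp_converges)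
  ultimately have E: "exp_op T f = exp p *\<^sub>C x0 + exp q *\<^sub>C x1 + exp r *\<^sub>C x2"
    unfolding exp_op_def by (simp add: sums_unique[symmetric])
  show "d0 (exp_op T f) = exp p * d0 f" "d1 (exp_op T f) = exp q * d1 f"
    "z \<in> ball 0 1 \<Longrightarrow> d2 (exp_op T f) z = exp r * d2 f z"
    unfolding E by (simp_all add: x_simps)
qed

text \<open>Since the entries are real, the exponentials multiply the components by unimodular
  constants and preserve each part of the norm. Linearity of \<open>S\<close> is itself derived from
  the components.\<close>

lemma diagonal_hermitian:
  fixes S :: "zygmund0 \<Rightarrow> zygmund0" and \<beta>\<^sub>0 \<beta>\<^sub>1 \<alpha> :: real
  assumes S: "\<And>f. d0 (S f) = of_real \<beta>\<^sub>0 * d0 f" "\<And>f. d1 (S f) = of_real \<beta>\<^sub>1 * d1 f"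
    "\<And>f z. z \<in> ball 0 1 \<Longrightarrow> d2 (S f) z = of_real \<alpha> * d2 f z"
  shows "bounded_hermitian S"
  unfolding bounded_hermitian_def
proof (intro conjI allI)
  have SC: "S (c *\<^sub>C x) = c *\<^sub>C S x" for c x
    by (rule zygmund0_eqI) (simp_all add: S jet_scaleC)
  have SA: "S (x + y) = S x + S y" for x y
    by (rule zygmund0_eqI) (simp_all add: S jet_add distrib_left)
  have "norm (S x) \<le> norm x * (\<bar>\<beta>\<^sub>0\<bar> + \<bar>\<beta>\<^sub>1\<bar> + \<bar>\<alpha>\<bar>)" for x
  proof -
    have "norm (S x) \<le> cmod (d0 (S x)) + cmod (d1 (S x)) + \<bar>\<alpha>\<bar> * norm x"
    proof (rule zygmund0_norm_le)
      fix z :: complex assume z: "z \<in> ball 0 1"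
      have "(1 - (cmod z)\<^sup>2) * cmod (d2 (S x) z) = \<bar>\<alpha>\<bar> * ((1 - (cmod z)\<^sup>2) * cmod (d2 x z))"
        by (simp add: S(3)[OF z] norm_mult)
      also have "\<dots> \<le> \<bar>\<alpha>\<bar> * norm x"
        using zygmund0_weight_le_norm[OF z] by (intro mult_left_mono) auto
      finally show "(1 - (cmod z)\<^sup>2) * cmod (d2 (S x) z) \<le> \<bar>\<alpha>\<bar> * norm x" .
    qed
    also have "\<dots> = \<bar>\<beta>\<^sub>0\<bar> * cmod (d0 x) + \<bar>\<beta>\<^sub>1\<bar> * cmod (d1 x) + \<bar>\<alpha>\<bar> * norm x"
      by (simp add: S norm_mult)
    also have "\<dots> \<le> \<bar>\<beta>\<^sub>0\<bar> * norm x + \<bar>\<beta>\<^sub>1\<bar> * norm x + \<bar>\<alpha>\<bar> * norm x"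
      using jet_functional_le_norm[of 1 0 0 0 x] jet_functional_le_norm[of 0 1 0 0 x]
      by (intro add_mono mult_left_mono) auto
    finally show ?thesis by (simp add: algebra_simps)
  qed
  then have "bounded_linear S"
    by (rule bounded_linear_intro[rotated 2]) (simp_all add: SA SC scaleR_scaleC)
  then show "bounded_clinear S" by (simp add: bounded_clinear_def SC)

  define U where "U t = exp_op (\<lambda>x. (\<i> * complex_of_real t) *\<^sub>C S x)" for t :: real
  have U: "d0 (U t x) = exp (\<i> * of_real (t * \<beta>\<^sub>0)) * d0 x"
    "d1 (U t x) = exp (\<i> * of_real (t * \<beta>\<^sub>1)) * d1 x"
    "z \<in> ball 0 1 \<Longrightarrow> d2 (U t x) z = exp (\<i> * of_real (t * \<alpha>)) * d2 x z" for t x z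
    unfolding U_def
    by (rule exp_op_diagonal[where p = "\<i> * of_real (t * \<beta>\<^sub>0)" and q = "\<i> * of_real (t * \<beta>\<^sub>1)"
          and r = "\<i> * of_real (t * \<alpha>)"]; simp add: jet_scaleC S)+
  \<comment> \<open>A right inverse of \<open>U t\<close>, which gives surjectivity.\<close>
  have inverse: "U t (U (- t) x) = x" for t x
    by (rule zygmund0_eqI) (simp_all add: U exp_minus)
  have U_diff: "U t x + (-1) *\<^sub>C U t y = U t (x + (-1) *\<^sub>C y)" for t x y
    by (rule zygmund0_eqI) (simp_all add: U jet_add jet_scaleC algebra_simps)
  have minus: "x - y = x + (-1) *\<^sub>C y" for x y :: zygmund0
    using scaleR_scaleC[of "-1" y] by simp
  have eq: "norm (U t x) = norm x" for t x
  proof -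
    have "(SUP z\<in>ball 0 1. (1 - (cmod z)\<^sup>2) * cmod (d2 (U t x) z)) = (SUP z\<in>ball 0 1. (1 - (cmod z)\<^sup>2) * cmod (d2 x z))"
      by (rule SUP_cong) (simp_all add: U norm_mult)
    moreover have "cmod (d0 (U t x)) = cmod (d0 x)" "cmod (d1 (U t x)) = cmod (d1 x)"
      by (simp_all add: U norm_mult)
    ultimately show ?thesis
      by (simp add: norm_zygmund0.rep_eq zygmund_norm_def d0_def d1_def d2_def)
  qed
  show "surj_isometry (exp_op (\<lambda>x. (\<i> * complex_of_real t) *\<^sub>C S x))" for t :: real
    unfolding surj_isometry_def U_def[symmetric]
  proof (intro conjI allI)
    show "dist (U t x) (U t y) = dist x y" for x y
      by (simp only: dist_norm minus U_diff eq)
    show "surj (U t)" by (rule surjI[of "U t" "U (- t)"]) (rule inverse)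
  qed
qed

theorem mainTheorem3:
  fixes S :: "zygmund0 \<Rightarrow> zygmund0"
  shows "bounded_hermitian S \<longleftrightarrow>
    (\<exists>\<alpha>\<^sub>1 \<alpha>\<^sub>2 \<alpha>\<^sub>3 :: real. \<forall>f. \<forall>z\<in>ball 0 1.
      Rep_zygmund0 (S f) z =
        of_real \<alpha>\<^sub>1 * Rep_zygmund0 f 0
        + of_real \<alpha>\<^sub>2 * deriv (Rep_zygmund0 f) 0 * z
        + of_real \<alpha>\<^sub>3 * Rep_zygmund0 f z)"
proof
  assume "bounded_hermitian S"
  then obtain \<beta>\<^sub>0 \<beta>\<^sub>1 \<alpha> :: real where
    S: "\<And>f. d0 (S f) = of_real \<beta>\<^sub>0 * d0 f" "\<And>f. d1 (S f) = of_real \<beta>\<^sub>1 * d1 f"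
      "\<And>f z. z \<in> ball 0 1 \<Longrightarrow> d2 (S f) z = of_real \<alpha> * d2 f z"
    by (rule hermitian_zygmund0_form) (rule that)
  \<comment> \<open>Subtracting \<open>\<alpha>\<close> corrects for the share of
    \<open>\<alpha> f\<close> in the value and the derivative at 0.\<close>
  have "\<forall>z\<in>ball 0 1. Rep_zygmund0 (S f) z = of_real (\<beta>\<^sub>0 - \<alpha>) * d0 f
      + of_real (\<beta>\<^sub>1 - \<alpha>) * d1 f * z + of_real \<alpha> * Rep_zygmund0 f z" for f
    unfolding affine_combination_iff by (simp add: S)
  then show "\<exists>\<alpha>\<^sub>1 \<alpha>\<^sub>2 \<alpha>\<^sub>3 :: real. \<forall>f. \<forall>z\<in>ball 0 1. Rep_zygmund0 (S f) z =
      of_real \<alpha>\<^sub>1 * Rep_zygmund0 f 0 + of_real \<alpha>\<^sub>2 * deriv (Rep_zygmund0 f) 0 * z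
      + of_real \<alpha>\<^sub>3 * Rep_zygmund0 f z"
    unfolding d0_def d1_def by blast
next
  assume "\<exists>\<alpha>\<^sub>1 \<alpha>\<^sub>2 \<alpha>\<^sub>3 :: real. \<forall>f. \<forall>z\<in>ball 0 1. Rep_zygmund0 (S f) z =
      of_real \<alpha>\<^sub>1 * Rep_zygmund0 f 0 + of_real \<alpha>\<^sub>2 * deriv (Rep_zygmund0 f) 0 * z
      + of_real \<alpha>\<^sub>3 * Rep_zygmund0 f z"
  then obtain \<alpha>\<^sub>1 \<alpha>\<^sub>2 \<alpha>\<^sub>3 :: real where "\<forall>z\<in>ball 0 1. Rep_zygmund0 (S f) z =
      of_real \<alpha>\<^sub>1 * d0 f + of_real \<alpha>\<^sub>2 * d1 f * z + of_real \<alpha>\<^sub>3 * Rep_zygmund0 f z" for f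
    unfolding d0_def d1_def by blast
  then show "bounded_hermitian S"
    unfolding affine_combination_iff
    by (intro diagonal_hermitian[of S "\<alpha>\<^sub>1 + \<alpha>\<^sub>3" "\<alpha>\<^sub>2 + \<alpha>\<^sub>3" \<alpha>\<^sub>3]) simp_all
qed

end
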